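(* Let $G$ be a finite nilpotent group and $H$ an arbitrary finite group with $|G|=|H|$. Then $C(G)\cong C(H)$ if and only if $H$ is nilpotent and, for every prime $p$, $C(G_p)\cong C(H_p)$, where $G_p$ and $H_p$ denote the Sylow $p$-subgroups of $G$ and $H$, respectively.
   Context: All groups are finite. For a group $X$, let $\mathrm{Cyc}(X)=\{x\in X : \langle x,y\rangle \text{ is cyclic for all } y\in X\}$. The cyclic graph $C(X)$ is the simple graph with vertex set $X\setminus \mathrm{Cyc}(X)$ in which two distinct vertices $x,y$ are adjacent iff $\langle x,y\rangle$ is cyclic. *)

theory Defs
  imports "HOL-Algebra.Algebra"
begin

fun lower_central :: "('a, 'b) monoid_scheme \<Rightarrow> nat \<Rightarrow> 'a set" where
  "lower_central G 0 = carrier G"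
| "lower_central G (Suc n) =
     generate G {x \<otimes>\<^bsub>G\<^esub> y \<otimes>\<^bsub>G\<^esub> inv\<^bsub>G\<^esub> x \<otimes>\<^bsub>G\<^esub> inv\<^bsub>G\<^esub> y
                 | x y. x \<in> carrier G \<and> y \<in> lower_central G n}"

definition nilpotent_group :: "('a, 'b) monoid_scheme \<Rightarrow> bool" where
  "nilpotent_group G \<longleftrightarrow> group G \<and> (\<exists>n. lower_central G n = {\<one>\<^bsub>G\<^esub>})"

definition sylow_subgroup :: "('a, 'b) monoid_scheme \<Rightarrow> nat \<Rightarrow> 'a set \<Rightarrow> bool" where
  "sylow_subgroup G p P \<longleftrightarrow> subgroup P G \<and> card P = p ^ Factorial_Ring.multiplicity p (order G)"

definition gen_cyclic :: "('a, 'b) monoid_scheme \<Rightarrow> 'a \<Rightarrow> 'a \<Rightarrow> bool" where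
  "gen_cyclic G x y \<longleftrightarrow> cyclic_group (subgroup_generated G {x, y})"

definition Cyc :: "('a, 'b) monoid_scheme \<Rightarrow> 'a set" where
  "Cyc G = {x \<in> carrier G. \<forall>y \<in> carrier G. gen_cyclic G x y}"

definition cyc_vertices :: "('a, 'b) monoid_scheme \<Rightarrow> 'a set" where
  "cyc_vertices G = carrier G - Cyc G"

definition cyc_adj :: "('a, 'b) monoid_scheme \<Rightarrow> 'a \<Rightarrow> 'a \<Rightarrow> bool" where
  "cyc_adj G x y \<longleftrightarrow> x \<noteq> y \<and> gen_cyclic G x y"

definition cyclic_graph_iso :: "('a, 'b) monoid_scheme \<Rightarrow> ('c, 'd) monoid_scheme \<Rightarrow> bool" where
  "cyclic_graph_iso G H \<longleftrightarrow>
     (\<exists>f. bij_betw f (cyc_vertices G) (cyc_vertices H) \<and>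
          (\<forall>x \<in> cyc_vertices G. \<forall>y \<in> cyc_vertices G. cyc_adj G x y \<longleftrightarrow> cyc_adj H (f x) (f y)))"

end

theory Submission
  imports Defs
begin

text \<open>Adding the vertices of \<^term>\<open>Cyc G\<close>, which are adjacent to everything, a graph isomorphism
  extends to a bijection \<open>f : G \<rightarrow> H\<close> such that \<open>\<langle>x, y\<rangle>\<close> is cyclic iff \<open>\<langle>f x, f y\<rangle>\<close> is. The elements
  whose closed neighbourhood contains that of \<open>x\<close> form a cyclic subgroup, the intersection of the
  maximal cyclic subgroups containing \<open>x\<close>, and \<open>f\<close> maps it onto the one of \<open>f x\<close>. As the number of
  solutions of \<open>y\<^sup>n = 1\<close> in a cyclic group depends only on its order, an induction shows that the
  class of \<open>x\<close> (the elements with the same closed neighbourhood) contains as many solutions as the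
  class of \<open>f x\<close>. Rearranging \<open>f\<close> within classes gives an adjacency preserving bijection between
  the solutions in \<open>G\<close> and in \<open>H\<close>, for every \<open>n\<close>.

  For \<open>n\<close> the full power of \<open>p\<close> dividing the order of the nilpotent group \<open>G\<close>, there are exactly
  \<open>n\<close> solutions, and they form the Sylow subgroup. So \<open>H\<close> also has only \<open>n\<close> solutions, which makes
  its Sylow subgroups unique and \<open>H\<close> nilpotent. Conversely, in nilpotent groups the bijections
  between the Sylow subgroups are glued along \<open>x = x\<^sup>a x\<^sup>b\<close> with \<open>a + b = 1\<close>.\<close>

subsection \<open>Pairs of elements generating a cyclic subgroup\<close>

lemma ex_max_nat:
  fixes f :: "'a \<Rightarrow> nat"
  assumes "finite A" "A \<noteq> {}"
  shows "\<exists>x\<in>A. \<forall>y\<in>A. f y \<le> f x"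
proof -
  have "Max (f ` A) \<in> f ` A" using assms by simp
  then obtain x where "x \<in> A" "Max (f ` A) = f x" by (rule imageE)
  then show ?thesis using assms(1) by (metis Max_ge finite_imageI imageI)
qed

lemma gen_cyclic_sym: "gen_cyclic G x y \<longleftrightarrow> gen_cyclic G y x"
  by (simp add: gen_cyclic_def insert_commute)

context group
begin

lemma gen_cyclicD:
  assumes "x \<in> carrier G" "y \<in> carrier G" "gen_cyclic G x y"
  obtains c and i j :: int where "c \<in> carrier G" "x = c [^] i" "y = c [^] j"
proof -
  let ?K = "subgroup_generated G {x, y}"
  obtain c where c: "c \<in> carrier ?K" "carrier ?K = range (\<lambda>n::int. c [^]\<^bsub>?K\<^esub> n)"
    using assms(3) group.cyclic_group[OF group_subgroup_generated] unfolding gen_cyclic_def by blast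
  have cG: "c \<in> carrier G"
    using c(1) carrier_subgroup_generated_subset by blast
  have "carrier ?K = range (\<lambda>n::int. c [^] n)"
    using c int_pow_subgroup_generated by (metis (mono_tags, lifting) image_cong)
  moreover have "x \<in> carrier ?K" "y \<in> carrier ?K"
    using assms(1,2) by (auto simp: carrier_subgroup_generated intro: generate.incl)
  ultimately show ?thesis using that cG by auto
qed

text \<open>The witness \<open>d\<close> is \<open>c [^] gcd i j\<close>. Writing it back as a
  product of powers of \<open>c [^] i\<close> and \<open>c [^] j\<close> keeps it inside every
  subgroup that contains those two elements.\<close>

lemma int_pow_bezout:
  fixes i j :: int
  assumes "c \<in> carrier G"
  obtains d and i' j' u v :: int where "d \<in> carrier G" "c [^] i = d [^] i'" "c [^] j = d [^] j'"
    "d = (c [^] i) [^] u \<otimes> (c [^] j) [^] v"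
proof -
  obtain u v where uv: "u * i + v * j = gcd i j" using bezout_int by blast
  obtain i' j' where ij: "i = gcd i j * i'" "j = gcd i j * j'"
    by (meson dvdE gcd_dvd1 gcd_dvd2)
  have "(c [^] i) [^] u \<otimes> (c [^] j) [^] v = c [^] (u * i + v * j)"
    using assms by (simp add: int_pow_pow int_pow_mult mult.commute)
  then have "c [^] gcd i j = (c [^] i) [^] u \<otimes> (c [^] j) [^] v" using uv by simp
  then show ?thesis
    using that[of "c [^] gcd i j" i' j' u v] ij assms by (metis int_pow_closed int_pow_pow)
qed

text \<open>Bezout turns cyclicity into equations between powers in \<open>G\<close>. In this form
  the generator inherits properties of \<open>x\<close> and \<open>y\<close>, such as membership in
  a subgroup or having a given exponent.\<close>

lemma gen_cyclic_iff_bezout: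
  assumes "x \<in> carrier G" "y \<in> carrier G"
  shows "gen_cyclic G x y \<longleftrightarrow> (\<exists>c\<in>carrier G. \<exists>(i::int) (j::int) (u::int) (v::int).
    x = c [^] i \<and> y = c [^] j \<and> c = x [^] u \<otimes> y [^] v)"
proof
  assume "gen_cyclic G x y"
  then obtain c and i j :: int where c: "c \<in> carrier G" "x = c [^] i" "y = c [^] j"
    using gen_cyclicD assms by blast
  obtain d and i' j' u v :: int where "d \<in> carrier G" "x = d [^] i'" "y = d [^] j'"
    "d = x [^] u \<otimes> y [^] v"
    using int_pow_bezout[OF c(1), of i j] c(2,3) by metis
  then show "\<exists>c\<in>carrier G. \<exists>(i::int) (j::int) (u::int) (v::int). x = c [^] i \<and> y = c [^] j \<and> c = x [^] u \<otimes> y [^] v"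
    by blast
next
  assume "\<exists>c\<in>carrier G. \<exists>(i::int) (j::int) (u::int) (v::int). x = c [^] i \<and> y = c [^] j \<and> c = x [^] u \<otimes> y [^] v"
  then obtain c and i j u v :: int where
    c: "c \<in> carrier G" "x = c [^] i" "y = c [^] j" "c = x [^] u \<otimes> y [^] v" by blast
  let ?K = "subgroup_generated G {x, y}"
  have K: "carrier ?K = generate G {x, y}"
    using assms by (simp add: carrier_subgroup_generated)
  have sub: "subgroup (generate G {x, y}) G" using generate_is_subgroup assms by simp
  have "x \<in> generate G {x, y}" "y \<in> generate G {x, y}" by (simp_all add: generate.incl)
  then have "x [^] u \<otimes> y [^] v \<in> generate G {x, y}"
    using subgroup_int_pow_closed[OF sub] subgroup.m_closed[OF sub] by blast
  then have cK: "c \<in> generate G {x, y}" using c(4) by simp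
  have "{x, y} \<subseteq> generate G {c}"
    using c generate_pow[OF c(1)] by blast
  then have "generate G {x, y} \<subseteq> generate G {c}"
    using c(1) generate_is_subgroup by (intro generate_subgroup_incl) auto
  moreover have "generate G {c} \<subseteq> generate G {x, y}"
    using cK sub by (intro generate_subgroup_incl) auto
  ultimately have "carrier ?K = range (\<lambda>n::int. c [^] n)"
    using K generate_pow[OF c(1)] by (auto simp: image_def)
  also have "\<dots> = range (\<lambda>n::int. c [^]\<^bsub>?K\<^esub> n)"
    using int_pow_subgroup_generated[of c] cK K by (intro image_cong) auto
  finally show "gen_cyclic G x y"
    unfolding gen_cyclic_def group.cyclic_group[OF group_subgroup_generated]
    using cK K by (intro bexI[of _ c]) auto
qed

lemma gen_cyclic_int_pow:
  assumes "c \<in> carrier G"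
  shows "gen_cyclic G (c [^] (i::int)) (c [^] (j::int))"
proof -
  obtain d and i' j' u v :: int where "d \<in> carrier G" "c [^] i = d [^] i'" "c [^] j = d [^] j'"
    "d = (c [^] i) [^] u \<otimes> (c [^] j) [^] v"
    using int_pow_bezout[OF assms] by blast
  then show ?thesis
    using gen_cyclic_iff_bezout[of "c [^] i" "c [^] j"] assms by blast
qed

lemma gen_cyclic_generate:
  assumes "c \<in> carrier G" "x \<in> generate G {c}" "y \<in> generate G {c}"
  shows "gen_cyclic G x y"
  using assms gen_cyclic_int_pow by (auto simp: generate_pow)

lemma gen_cyclic_iff:
  assumes "x \<in> carrier G" "y \<in> carrier G"
  shows "gen_cyclic G x y \<longleftrightarrow> (\<exists>c\<in>carrier G. x \<in> generate G {c} \<and> y \<in> generate G {c})"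
proof
  assume "gen_cyclic G x y"
  then show "\<exists>c\<in>carrier G. x \<in> generate G {c} \<and> y \<in> generate G {c}"
    using gen_cyclicD assms by (metis (mono_tags, lifting) generate_pow mem_Collect_eq UNIV_I)
qed (use gen_cyclic_generate in blast)

lemma gen_cyclic_refl: "x \<in> carrier G \<Longrightarrow> gen_cyclic G x x"
  using gen_cyclic_generate[of x x x] by (simp add: generate.incl)

text \<open>The Bezout generator is a product of powers of \<open>x\<close> and \<open>y\<close>,
  hence already an element of \<open>P\<close>, and powers agree in \<open>P\<close> and
  \<open>G\<close>.\<close>

lemma gen_cyclic_subgroup:
  assumes P: "subgroup P G" and xy: "x \<in> P" "y \<in> P"
  shows "gen_cyclic (G\<lparr>carrier := P\<rparr>) x y \<longleftrightarrow> gen_cyclic G x y"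
proof -
  interpret P: group "G\<lparr>carrier := P\<rparr>" using P subgroup.subgroup_is_group is_group by blast
  have PG: "P \<subseteq> carrier G" using P subgroup.subset by blast
  have pw: "z [^]\<^bsub>G\<lparr>carrier := P\<rparr>\<^esub> (n::int) = z [^] n" if "z \<in> P" for z n
    using int_pow_consistent[OF P that] by simp
  have "gen_cyclic (G\<lparr>carrier := P\<rparr>) x y \<longleftrightarrow> (\<exists>c\<in>P. \<exists>(i::int) (j::int) (u::int) (v::int).
    x = c [^] i \<and> y = c [^] j \<and> c = x [^] u \<otimes> y [^] v)"
    using P.gen_cyclic_iff_bezout[of x y] xy by (simp add: pw)
  also have "\<dots> \<longleftrightarrow> gen_cyclic G x y"
  proof -
    have "x [^] u \<otimes> y [^] v \<in> P" for u v :: int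
      using xy P by (simp add: subgroup_int_pow_closed subgroup.m_closed)
    then show ?thesis
      using gen_cyclic_iff_bezout[of x y] xy PG by (metis in_mono)
  qed
  finally show ?thesis .
qed

lemma gen_cyclic_adjoin:
  assumes "gen_cyclic G x y" "x \<in> carrier G" "y \<in> carrier G"
  obtains d and u v :: int where "d \<in> carrier G" "d = x [^] u \<otimes> y [^] v"
    "x \<in> generate G {d}" "y \<in> generate G {d}" 
  using assms gen_cyclic_iff_bezout[of x y] generate_pow that
  by (metis (mono_tags, lifting) mem_Collect_eq UNIV_I)

section \<open>Maximal cyclic subgroups\<close>

lemma generate_singleton_eqI:
  assumes "finite (carrier G)" "c \<in> carrier G" "d \<in> carrier G" "c \<in> generate G {d}" "ord d \<le> ord c"
  shows "generate G {c} = generate G {d}"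
proof (rule card_subset_eq)
  have sub: "subgroup (generate G {d}) G" using assms generate_is_subgroup by simp
  show "generate G {c} \<subseteq> generate G {d}"
    using assms sub by (intro generate_subgroup_incl) auto
  then have "card (generate G {c}) \<le> card (generate G {d})"
    using assms sub by (meson card_mono finite_subset subgroup.subset)
  then show "card (generate G {c}) = card (generate G {d})"
    using assms generate_pow_card by simp
  show "finite (generate G {d})"
    using assms sub by (meson finite_subset subgroup.subset)
qed

text \<open>Among the cyclic subgroups containing \<open>x\<close> and \<open>z\<close>, take one of
  largest order. The last conclusion expresses its maximality: an element generating a cyclic
  subgroup together with \<open>c\<close> cannot lie outside.\<close>

lemma maximal_cyclic:
  assumes fin: "finite (carrier G)" and xz: "x \<in> carrier G" "z \<in> carrier G" "gen_cyclic G x z"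
  obtains c where "c \<in> carrier G" "x \<in> generate G {c}" "z \<in> generate G {c}"
    "\<And>y. y \<in> carrier G \<Longrightarrow> gen_cyclic G c y \<Longrightarrow> y \<in> generate G {c}"
proof -
  let ?C = "{c \<in> carrier G. x \<in> generate G {c} \<and> z \<in> generate G {c}}"
  have "?C \<noteq> {}" "finite ?C" using gen_cyclic_iff xz fin by auto
  then obtain c where c: "c \<in> ?C" "\<And>d. d \<in> ?C \<Longrightarrow> ord d \<le> ord c"
    using ex_max_nat[of ?C ord] by blast
  have "y \<in> generate G {c}" if y: "y \<in> carrier G" "gen_cyclic G c y" for y
  proof -
    obtain d where d: "d \<in> carrier G" "c \<in> generate G {d}" "y \<in> generate G {d}"
      using gen_cyclic_iff[of c y] y c(1) by auto
    have "generate G {c} \<subseteq> generate G {d}"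
      using d generate_is_subgroup[of "{d}"] by (intro generate_subgroup_incl) auto
    then have "ord d \<le> ord c" using c d(1) by blast
    then show ?thesis using generate_singleton_eqI[OF fin _ d(1,2)] c(1) d(3) by simp
  qed
  then show ?thesis using that[of c] c(1) by blast
qed

text \<open>An element \<open>c\<close> of largest order generates \<open>S\<close>: for
  \<open>y\<close> in \<open>S\<close>, a generator \<open>d\<close> of the cyclic group of
  \<open>c\<close> and \<open>y\<close> lies in \<open>S\<close> again, so its order cannot exceed
  that of \<open>c\<close>.\<close>

lemma pairwise_gen_cyclic_imp_cyclic:
  assumes fin: "finite (carrier G)" and S: "subgroup S G"
    and pw: "\<And>x y. x \<in> S \<Longrightarrow> y \<in> S \<Longrightarrow> gen_cyclic G x y"
  obtains c where "c \<in> S" "S = generate G {c}"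
proof -
  have SG: "S \<subseteq> carrier G" using S subgroup.subset by blast
  have "S \<noteq> {}" "finite S" using S subgroup.one_closed fin SG finite_subset by auto
  then obtain c where c: "c \<in> S" "\<And>d. d \<in> S \<Longrightarrow> ord d \<le> ord c"
    using ex_max_nat[of S ord] by blast
  have "y \<in> generate G {c}" if y: "y \<in> S" for y
  proof -
    obtain d and u v :: int where d: "d \<in> carrier G" "d = c [^] u \<otimes> y [^] v"
      "c \<in> generate G {d}" "y \<in> generate G {d}"
      using gen_cyclic_adjoin[OF pw[OF c(1) y]] c(1) y SG by blast
    have "d \<in> S" using d(2) c(1) y S by (simp add: subgroup_int_pow_closed subgroup.m_closed)
    then show ?thesis using generate_singleton_eqI[OF fin _ d(1,3)] c d(4) SG by auto
  qed
  moreover have "generate G {c} \<subseteq> S" using c(1) S by (intro generate_subgroup_incl) auto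
  ultimately show ?thesis using that c(1) by blast
qed

end

subsection \<open>Counting torsion elements by the cyclic graph\<close>

definition torsion :: "('a, 'b) monoid_scheme \<Rightarrow> nat \<Rightarrow> 'a set" where
  "torsion G n = {x \<in> carrier G. x [^]\<^bsub>G\<^esub> n = \<one>\<^bsub>G\<^esub>}"

text \<open>The closed neighbourhood in the graph on the whole carrier, with the elements of
  \<open>Cyc G\<close> put back in.\<close>

definition cyc_nbhd :: "('a, 'b) monoid_scheme \<Rightarrow> 'a \<Rightarrow> 'a set" where
  "cyc_nbhd G x = {z \<in> carrier G. gen_cyclic G x z}"

definition cyc_core :: "('a, 'b) monoid_scheme \<Rightarrow> 'a \<Rightarrow> 'a set" where
  "cyc_core G x = {y \<in> carrier G. cyc_nbhd G x \<subseteq> cyc_nbhd G y}"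

text \<open>Stated for subsets rather than groups, because it is applied to torsion sets before
  these are known to be subgroups. Using \<open>gen_cyclic\<close> in place of
  \<open>cyc_adj\<close> avoids case distinctions on equality.\<close>

definition cyc_iso ::
    "('a, 'b) monoid_scheme \<Rightarrow> 'a set \<Rightarrow> ('c, 'd) monoid_scheme \<Rightarrow> 'c set \<Rightarrow> ('a \<Rightarrow> 'c) \<Rightarrow> bool" where
  "cyc_iso G A H B f \<longleftrightarrow> bij_betw f A B \<and>
     (\<forall>x\<in>A. \<forall>y\<in>A. gen_cyclic G x y \<longleftrightarrow> gen_cyclic H (f x) (f y))"

context group
begin

text \<open>Let \<open>c\<close> generate a maximal cyclic subgroup through \<open>x\<close> and
  \<open>z\<close>. Since \<open>c\<close> is a neighbour of \<open>x\<close>, every element of the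
  core is a neighbour of \<open>c\<close>, and maximality puts it into that subgroup.\<close>

lemma cyc_core_subset_maximal_cyclic:
  assumes "finite (carrier G)" "x \<in> carrier G" "z \<in> cyc_nbhd G x"
  obtains c where "c \<in> carrier G" "z \<in> generate G {c}" "cyc_core G x \<subseteq> generate G {c}"
proof -
  obtain c where c: "c \<in> carrier G" "x \<in> generate G {c}" "z \<in> generate G {c}"
    "\<And>y. y \<in> carrier G \<Longrightarrow> gen_cyclic G c y \<Longrightarrow> y \<in> generate G {c}"
    using maximal_cyclic[of x z] assms unfolding cyc_nbhd_def by blast
  have "gen_cyclic G x c"
    using gen_cyclic_generate[OF c(1,2)] by (simp add: generate.incl)
  then have "c \<in> cyc_nbhd G x" using c(1) by (simp add: cyc_nbhd_def)
  then have "cyc_core G x \<subseteq> generate G {c}"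
    using c(1,4) gen_cyclic_sym[of G c] unfolding cyc_core_def cyc_nbhd_def by blast
  then show ?thesis using that c by blast
qed

text \<open>For each neighbour \<open>z\<close> of \<open>x\<close>, some cyclic subgroup contains
  both \<open>z\<close> and the whole core, so products and inverses of core elements remain
  neighbours of \<open>z\<close>. The case \<open>z = x\<close> shows that any two core elements lie
  in a common cyclic subgroup.\<close>

lemma cyc_core_cyclic:
  assumes fin: "finite (carrier G)" and x: "x \<in> carrier G"
  obtains c where "c \<in> carrier G" "cyc_core G x = generate G {c}"
proof -
  have sub: "subgroup (cyc_core G x) G"
  proof (rule subgroupI)
    show "cyc_core G x \<subseteq> carrier G" by (auto simp: cyc_core_def)
    show "cyc_core G x \<noteq> {}" using x by (auto simp: cyc_core_def)
  next
    fix a assume a: "a \<in> cyc_core G x"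
    have "cyc_nbhd G x \<subseteq> cyc_nbhd G (inv a)"
    proof
      fix z assume z: "z \<in> cyc_nbhd G x"
      then obtain c where c: "c \<in> carrier G" "z \<in> generate G {c}" "cyc_core G x \<subseteq> generate G {c}"
        using cyc_core_subset_maximal_cyclic fin x by blast
      then have "inv a \<in> generate G {c}" using a generate_m_inv_closed[of "{c}"] by auto
      then show "z \<in> cyc_nbhd G (inv a)"
        using gen_cyclic_generate c z by (auto simp: cyc_nbhd_def)
    qed
    then show "inv a \<in> cyc_core G x" using a by (simp add: cyc_core_def)
  next
    fix a b assume a: "a \<in> cyc_core G x" and b: "b \<in> cyc_core G x"
    have "cyc_nbhd G x \<subseteq> cyc_nbhd G (a \<otimes> b)"
    proof
      fix z assume z: "z \<in> cyc_nbhd G x"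
      then obtain c where c: "c \<in> carrier G" "z \<in> generate G {c}" "cyc_core G x \<subseteq> generate G {c}"
        using cyc_core_subset_maximal_cyclic fin x by blast
      then have "a \<otimes> b \<in> generate G {c}" using a b by (auto intro: generate.eng)
      then show "z \<in> cyc_nbhd G (a \<otimes> b)"
        using gen_cyclic_generate c z by (auto simp: cyc_nbhd_def)
    qed
    then show "a \<otimes> b \<in> cyc_core G x" using a b by (simp add: cyc_core_def)
  qed
  have "x \<in> cyc_nbhd G x" using x gen_cyclic_refl by (simp add: cyc_nbhd_def)
  then obtain c where "c \<in> carrier G" "cyc_core G x \<subseteq> generate G {c}"
    using cyc_core_subset_maximal_cyclic fin x by blast
  then have "gen_cyclic G a b" if "a \<in> cyc_core G x" "b \<in> cyc_core G x" for a b
    using that gen_cyclic_generate by blast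
  then show ?thesis
    using pairwise_gen_cyclic_imp_cyclic[OF fin sub] that subgroup.subset[OF sub] by blast
qed

text \<open>The power \<open>c [^] i\<close> has exponent \<open>n\<close> iff \<open>ord c\<close>
  divides \<open>i * n\<close>. What matters is the shape of the right-hand side: it depends only on
  \<open>n\<close> and the order of the cyclic subgroup.\<close>

lemma card_torsion_cyclic:
  assumes fin: "finite (carrier G)" and c: "c \<in> carrier G"
  shows "card (generate G {c} \<inter> torsion G n) =
    card {i. i < card (generate G {c}) \<and> card (generate G {c}) dvd i * n}"
proof -
  have pos: "ord c > 0" using ord_ge_1[OF fin c] by simp
  have gen: "generate G {c} = (\<lambda>i. c [^] i) ` {..<ord c}"
    using generate_pow_on_finite_carrier[OF fin c] ord_elems[OF fin c] pos by auto
  have inj: "inj_on (\<lambda>i. c [^] i) {..<ord c}"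
    using ord_inj[OF c] by (rule inj_on_subset) auto
  have "generate G {c} \<inter> torsion G n = (\<lambda>i. c [^] i) ` {i. i < ord c \<and> ord c dvd i * n}"
    unfolding gen torsion_def using c by (auto simp: nat_pow_pow pow_eq_id)
  moreover have "inj_on (\<lambda>i. c [^] i) {i. i < ord c \<and> ord c dvd i * n}"
    using inj by (rule inj_on_subset) auto
  ultimately show ?thesis
    using generate_pow_card[OF c] by (simp add: card_image)
qed

lemma card_cyc_core_torsion:
  assumes "finite (carrier G)" "x \<in> carrier G"
  shows "card (cyc_core G x \<inter> torsion G n) =
    card {i. i < card (cyc_core G x) \<and> card (cyc_core G x) dvd i * n}"
proof -
  obtain c where c: "c \<in> carrier G" "cyc_core G x = generate G {c}"
    using cyc_core_cyclic[OF assms] by blast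
  show ?thesis unfolding c(2) by (rule card_torsion_cyclic[OF assms(1) c(1)])
qed

end

text \<open>Glues bijections chosen fibre by fibre. It serves to rearrange a graph isomorphism
  inside classes of elements with equal neighbourhoods.\<close>

lemma bij_betw_fibres:
  fixes f :: "'a \<Rightarrow> 'c" and g :: "'b \<Rightarrow> 'c"
  assumes "finite A" "finite B"
    and "\<And>k. card {a \<in> A. f a = k} = card {b \<in> B. g b = k}"
  obtains h where "bij_betw h A B" "\<And>a. a \<in> A \<Longrightarrow> g (h a) = f a"
proof -
  have "\<exists>h. bij_betw h {a \<in> A. f a = k} {b \<in> B. g b = k}" for k
    using assms by (intro finite_same_card_bij) auto
  then have "\<forall>k. \<exists>h. bij_betw h {a \<in> A. f a = k} {b \<in> B. g b = k}" by simp
  from choice[OF this] obtain h where h: "\<And>k. bij_betw (h k) {a \<in> A. f a = k} {b \<in> B. g b = k}"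
    by blast
  define h' where "h' a = h (f a) a" for a
  have mem: "h' a \<in> B \<and> g (h' a) = f a" if "a \<in> A" for a
    using bij_betwE[OF h, of "f a"] that by (auto simp: h'_def)
  moreover have "inj_on h' A"
  proof (rule inj_onI)
    fix a b assume ab: "a \<in> A" "b \<in> A" "h' a = h' b"
    then have "f a = f b" using mem by metis
    then show "a = b" using ab h[of "f b"] by (auto simp: h'_def bij_betw_def dest: inj_onD)
  qed
  moreover have "B \<subseteq> h' ` A"
  proof
    fix b assume "b \<in> B"
    then have "b \<in> h (g b) ` {a \<in> A. f a = g b}" using h[of "g b"] by (auto simp: bij_betw_def)
    then obtain a where "a \<in> A" "f a = g b" "b = h (g b) a" by blast
    then show "b \<in> h' ` A" by (intro image_eqI[of _ _ a]) (simp_all add: h'_def)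
  qed
  ultimately show ?thesis using that[of h'] by (auto simp: bij_betw_def)
qed

section \<open>Transport of neighbourhoods, cores and torsion counts\<close>

lemma cyc_iso_cyc_nbhd:
  assumes f: "cyc_iso G (carrier G) H (carrier H) f" and x: "x \<in> carrier G"
  shows "cyc_nbhd H (f x) = f ` cyc_nbhd G x"
proof -
  have surj: "f ` carrier G = carrier H" using f by (auto simp: cyc_iso_def bij_betw_def)
  show ?thesis
    using f x unfolding cyc_nbhd_def surj[symmetric] by (auto simp: cyc_iso_def)
qed

lemma cyc_iso_cyc_core:
  assumes f: "cyc_iso G (carrier G) H (carrier H) f" and x: "x \<in> carrier G"
  shows "cyc_core H (f x) = f ` cyc_core G x"
proof -
  have inj: "inj_on f (carrier G)" and surj: "f ` carrier G = carrier H"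
    using f by (auto simp: cyc_iso_def bij_betw_def)
  have iff: "cyc_nbhd H (f x) \<subseteq> cyc_nbhd H (f y) \<longleftrightarrow> cyc_nbhd G x \<subseteq> cyc_nbhd G y"
    if y: "y \<in> carrier G" for y
  proof -
    have sub: "cyc_nbhd G x \<subseteq> carrier G" "cyc_nbhd G y \<subseteq> carrier G" by (auto simp: cyc_nbhd_def)
    have "f ` cyc_nbhd G x \<subseteq> f ` cyc_nbhd G y \<longleftrightarrow> (\<forall>z\<in>cyc_nbhd G x. f z \<in> f ` cyc_nbhd G y)"
      by (rule image_subset_iff)
    also have "\<dots> \<longleftrightarrow> (\<forall>z\<in>cyc_nbhd G x. z \<in> cyc_nbhd G y)"
      using sub by (intro ball_cong refl inj_on_image_mem_iff[OF inj]) auto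
    finally show ?thesis
      using cyc_iso_cyc_nbhd[OF f y] cyc_iso_cyc_nbhd[OF f x] by (simp add: subset_eq)
  qed
  have "{w \<in> f ` carrier G. cyc_nbhd H (f x) \<subseteq> cyc_nbhd H w} =
      f ` {y \<in> carrier G. cyc_nbhd H (f x) \<subseteq> cyc_nbhd H (f y)}" by blast
  also have "\<dots> = f ` {y \<in> carrier G. cyc_nbhd G x \<subseteq> cyc_nbhd G y}"
    using iff by (intro arg_cong[where f = "image f"]) auto
  finally show ?thesis unfolding cyc_core_def surj .
qed

lemma card_sum_fibres:
  assumes "finite A"
  shows "card A = (\<Sum>k\<in>f ` A. card {a \<in> A. f a = k})"
  using sum.image_gen[OF assms, of "\<lambda>_. 1::nat" f] by simp

text \<open>The torsion of \<^term>\<open>cyc_core G x\<close> is the disjoint union of the torsion of the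
  twin classes it contains; all of them but the class of \<^term>\<open>x\<close> have a smaller core.\<close>

lemma cyc_iso_card_torsion_class:
  assumes G: "group G" and H: "group H" and fin: "finite (carrier G)" 
    and f: "cyc_iso G (carrier G) H (carrier H) f" and x: "x \<in> carrier G"
  shows "card {y \<in> torsion G n. cyc_nbhd G y = cyc_nbhd G x} =
    card {y \<in> torsion H n. cyc_nbhd H y = cyc_nbhd H (f x)}"
  using x
proof (induction "card (cyc_core G x)" arbitrary: x rule: less_induct)
  case less
  note x = \<open>x \<in> carrier G\<close>
  have inj: "inj_on f (carrier G)" and surj: "f ` carrier G = carrier H"
    using f by (auto simp: cyc_iso_def bij_betw_def)
  have finH: "finite (carrier H)" using surj fin by (metis finite_imageI)
  define a where "a K = card {y \<in> torsion G n. cyc_nbhd G y = K}" for K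
  define b where "b K = card {y \<in> torsion H n. cyc_nbhd H y = K}" for K
  \<comment> \<open>Twin classes are indexed by their common neighbourhood; \<open>?I\<close> lists
    those inside the core of \<open>x\<close>.\<close>
  let ?I = "cyc_nbhd G ` cyc_core G x"
  have coreG: "cyc_core G x \<subseteq> carrier G" by (auto simp: cyc_core_def)
  have coreH: "cyc_core H (f x) \<subseteq> carrier H" by (auto simp: cyc_core_def)
  have finI: "finite ?I" using coreG fin finite_subset by blast
  have xI: "cyc_nbhd G x \<in> ?I" using x by (auto simp: cyc_core_def)
  have sumG: "card (cyc_core G x \<inter> torsion G n) = (\<Sum>K\<in>?I. a K)"
  proof -
    let ?A = "cyc_core G x \<inter> torsion G n"
    have "card ?A = (\<Sum>K\<in>cyc_nbhd G ` ?A. card {y \<in> ?A. cyc_nbhd G y = K})"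
      using finite_subset[OF coreG fin] by (intro card_sum_fibres) auto
    \<comment> \<open>Classes without any torsion element contribute empty fibres, so the sum may
      run over all of \<open>?I\<close>.\<close>
    also have "\<dots> = (\<Sum>K\<in>?I. card {y \<in> ?A. cyc_nbhd G y = K})"
      using finI by (intro sum.mono_neutral_left) (auto intro: card_eq_0_iff[THEN iffD2])
    also have "\<dots> = (\<Sum>K\<in>?I. a K)"
      unfolding a_def by (intro sum.cong refl arg_cong[where f = card])
        (auto simp: cyc_core_def torsion_def)
    finally show ?thesis .
  qed
  have sumH: "card (cyc_core H (f x) \<inter> torsion H n) = (\<Sum>K\<in>?I. b (f ` K))"
  proof -
    let ?A = "cyc_core H (f x) \<inter> torsion H n"
    let ?J = "cyc_nbhd H ` cyc_core H (f x)"
    have J: "?J = (\<lambda>K. f ` K) ` ?I"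
      unfolding cyc_iso_cyc_core[OF f x] image_image
      using cyc_iso_cyc_nbhd[OF f] coreG by (intro image_cong) auto
    have "inj_on (\<lambda>K. f ` K) ?I"
      using inj_on_image_Pow[OF inj] by (rule inj_on_subset) (auto simp: cyc_nbhd_def)
    have "card ?A = (\<Sum>K\<in>cyc_nbhd H ` ?A. card {y \<in> ?A. cyc_nbhd H y = K})"
      using finite_subset[OF coreH finH] by (intro card_sum_fibres) auto
    also have "\<dots> = (\<Sum>K\<in>?J. card {y \<in> ?A. cyc_nbhd H y = K})"
      using finite_subset[OF coreH finH]
      by (intro sum.mono_neutral_left) (auto intro: card_eq_0_iff[THEN iffD2])
    also have "\<dots> = (\<Sum>K\<in>?J. b K)"
      unfolding b_def by (intro sum.cong refl arg_cong[where f = card])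
        (auto simp: cyc_core_def torsion_def)
    also have "\<dots> = (\<Sum>K\<in>?I. b (f ` K))"
      unfolding J using \<open>inj_on (\<lambda>K. f ` K) ?I\<close> by (simp add: sum.reindex)
    finally show ?thesis .
  qed
  have others: "a K = b (f ` K)" if K: "K \<in> ?I - {cyc_nbhd G x}" for K
  proof -
    obtain z where z: "z \<in> cyc_core G x" "K = cyc_nbhd G z" using K by auto
    then have zG: "z \<in> carrier G" and "cyc_nbhd G x \<subset> cyc_nbhd G z"
      using K by (auto simp: cyc_core_def)
    \<comment> \<open>The inclusion is strict because \<open>x\<close> lies in its own core but not
      in that of \<open>z\<close>.\<close>
    then have "cyc_core G z \<subset> cyc_core G x" using x by (auto simp: cyc_core_def)
    then have "card (cyc_core G z) < card (cyc_core G x)"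
      using psubset_card_mono finite_subset[OF coreG fin] by blast
    from less.hyps[OF this zG] show ?thesis
      using cyc_iso_cyc_nbhd[OF f zG] z(2) by (simp add: a_def b_def)
  qed
  have "card (cyc_core H (f x)) = card (cyc_core G x)"
    unfolding cyc_iso_cyc_core[OF f x] using inj coreG by (meson card_image inj_on_subset)
  \<comment> \<open>Both cores are cyclic of the same order, hence contain equally many torsion
    elements.\<close>
  then have "(\<Sum>K\<in>?I. a K) = (\<Sum>K\<in>?I. b (f ` K))"
    using group.card_cyc_core_torsion[OF G fin x, of n]
      group.card_cyc_core_torsion[OF H finH, of "f x" n] surj x sumG sumH
    by (metis imageI)
  then have "a (cyc_nbhd G x) + (\<Sum>K\<in>?I - {cyc_nbhd G x}. a K) =
      b (f ` cyc_nbhd G x) + (\<Sum>K\<in>?I - {cyc_nbhd G x}. b (f ` K))"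
    using finI xI by (simp add: sum.remove[of ?I "cyc_nbhd G x"])
  also have "(\<Sum>K\<in>?I - {cyc_nbhd G x}. a K) = (\<Sum>K\<in>?I - {cyc_nbhd G x}. b (f ` K))"
    using others by (intro sum.cong) auto
  finally have "a (cyc_nbhd G x) = b (f ` cyc_nbhd G x)" by simp
  then show ?case using cyc_iso_cyc_nbhd[OF f x] by (simp add: a_def b_def)
qed

text \<open>The map \<open>f\<close> itself need not preserve torsion. It is replaced by a bijection
  \<open>g\<close> with \<open>g y\<close> in the twin class of \<open>f y\<close>; adjacency
  survives because it depends only on neighbourhoods.\<close>

lemma cyc_iso_torsion:
  assumes G: "group G" and H: "group H" and fin: "finite (carrier G)" 
    and f: "cyc_iso G (carrier G) H (carrier H) f"
  obtains g where "cyc_iso G (torsion G n) H (torsion H n) g"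
proof -
  have inj: "inj_on f (carrier G)" and surj: "f ` carrier G = carrier H"
    using f by (auto simp: cyc_iso_def bij_betw_def)
  have finH: "finite (carrier H)" using surj fin by (metis finite_imageI)
  have tG: "torsion G n \<subseteq> carrier G" and tH: "torsion H n \<subseteq> carrier H"
    by (auto simp: torsion_def)
  have "card {y \<in> torsion G n. cyc_nbhd H (f y) = K} = card {y \<in> torsion H n. cyc_nbhd H y = K}" for K
  proof (cases "\<exists>x\<in>carrier G. K = cyc_nbhd H (f x)")
    case True
    then obtain x where x: "x \<in> carrier G" "K = cyc_nbhd H (f x)" by blast
    have "cyc_nbhd H (f y) = K \<longleftrightarrow> cyc_nbhd G y = cyc_nbhd G x" if "y \<in> carrier G" for y
      using cyc_iso_cyc_nbhd[OF f] that x inj_on_image_eq_iff[OF inj] by (simp add: cyc_nbhd_def)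
    then have "{y \<in> torsion G n. cyc_nbhd H (f y) = K} =
        {y \<in> torsion G n. cyc_nbhd G y = cyc_nbhd G x}"
      using tG by auto
    then show ?thesis using cyc_iso_card_torsion_class[OF G H fin f x(1), of n] x(2) by simp
  next
    case False
    then have "{y \<in> torsion G n. cyc_nbhd H (f y) = K} = {}"
      "{y \<in> torsion H n. cyc_nbhd H y = K} = {}"
      using tG tH unfolding surj[symmetric] by blast+
    then show ?thesis by (simp only: card.empty)
  qed
  then obtain g where g: "bij_betw g (torsion G n) (torsion H n)"
      "\<And>y. y \<in> torsion G n \<Longrightarrow> cyc_nbhd H (g y) = cyc_nbhd H (f y)"
    using bij_betw_fibres[of "torsion G n" "torsion H n" "\<lambda>y. cyc_nbhd H (f y)" "cyc_nbhd H"]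
      finite_subset[OF tG fin] finite_subset[OF tH finH] by blast
  have gH: "g y \<in> carrier H" "f y \<in> carrier H" if "y \<in> torsion G n" for y
    using g(1) that tH tG surj by (auto dest: bij_betwE)
  have "gen_cyclic G x y \<longleftrightarrow> gen_cyclic H (g x) (g y)"
    if x: "x \<in> torsion G n" and y: "y \<in> torsion G n" for x y
  proof -
    have "gen_cyclic G x y \<longleftrightarrow> f y \<in> cyc_nbhd H (f x)"
    proof -
      have "x \<in> carrier G" "y \<in> carrier G" using x y tG by auto
      then show ?thesis using f gH(2)[OF y] unfolding cyc_iso_def cyc_nbhd_def by simp
    qed
    also have "\<dots> \<longleftrightarrow> gen_cyclic H (g x) (f y)"
      using g(2)[OF x, symmetric] gH(2)[OF y] by (simp add: cyc_nbhd_def)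
    also have "\<dots> \<longleftrightarrow> gen_cyclic H (f y) (g x)"
      by (rule gen_cyclic_sym)
    also have "\<dots> \<longleftrightarrow> g x \<in> cyc_nbhd H (g y)"
      using g(2)[OF y] gH(1)[OF x] by (simp add: cyc_nbhd_def)
    also have "\<dots> \<longleftrightarrow> gen_cyclic H (g y) (g x)"
      using gH(1)[OF x] by (simp add: cyc_nbhd_def)
    also have "\<dots> \<longleftrightarrow> gen_cyclic H (g x) (g y)"
      by (rule gen_cyclic_sym)
    finally show ?thesis .
  qed
  then show ?thesis using that g(1) by (auto simp: cyc_iso_def)
qed

section \<open>Graph isomorphisms as bijections of the whole groups\<close>

lemma cyclic_graph_iso_iff_cyc_iso:
  assumes G: "group G" and H: "group H" and fin: "finite (carrier G)" "finite (carrier H)"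
    and ord: "order G = order H"
  shows "cyclic_graph_iso G H \<longleftrightarrow> (\<exists>f. cyc_iso G (carrier G) H (carrier H) f)"
proof
  assume "cyclic_graph_iso G H"
  then obtain f where f: "bij_betw f (cyc_vertices G) (cyc_vertices H)"
    "\<And>x y. x \<in> cyc_vertices G \<Longrightarrow> y \<in> cyc_vertices G \<Longrightarrow> cyc_adj G x y \<longleftrightarrow> cyc_adj H (f x) (f y)"
    unfolding cyclic_graph_iso_def by blast
  have sub: "Cyc G \<subseteq> carrier G" "Cyc H \<subseteq> carrier H" by (auto simp: Cyc_def)
  \<comment> \<open>The graphs have equally many vertices and the groups have equal order, so the
    removed sets match in size and any bijection between them can be adjoined.\<close>
  have "card (Cyc G) = card (Cyc H)"
  proof -
    have "card (carrier G) - card (Cyc G) = card (carrier H) - card (Cyc H)"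
      using bij_betw_same_card[OF f(1)] sub fin finite_subset
      unfolding cyc_vertices_def by (metis card_Diff_subset)
    moreover have "card (Cyc G) \<le> card (carrier G)" "card (Cyc H) \<le> card (carrier H)"
      using sub fin by (auto intro: card_mono)
    ultimately show ?thesis using ord by (simp add: order_def)
  qed
  then obtain h where h: "bij_betw h (Cyc G) (Cyc H)"
    using sub fin finite_subset finite_same_card_bij by metis
  define k where "k x = (if x \<in> Cyc G then h x else f x)" for x
  have "bij_betw k (Cyc G) (Cyc H)"
    using h by (rule bij_betw_cong[THEN iffD1, rotated]) (simp add: k_def)
  moreover have "bij_betw k (cyc_vertices G) (cyc_vertices H)"
    using f(1) by (rule bij_betw_cong[THEN iffD1, rotated]) (simp add: k_def cyc_vertices_def)
  ultimately have "bij_betw k (Cyc G \<union> cyc_vertices G) (Cyc H \<union> cyc_vertices H)"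
    by (rule bij_betw_combine) (auto simp: cyc_vertices_def)
  moreover have "Cyc G \<union> cyc_vertices G = carrier G" "Cyc H \<union> cyc_vertices H = carrier H"
    using sub by (auto simp: cyc_vertices_def)
  ultimately have bij: "bij_betw k (carrier G) (carrier H)" by simp
  have "gen_cyclic G x y \<longleftrightarrow> gen_cyclic H (k x) (k y)" if xy: "x \<in> carrier G" "y \<in> carrier G" for x y
  proof -
    have kxy: "k x \<in> carrier H" "k y \<in> carrier H" using xy bij bij_betwE by blast+
    consider "x \<in> Cyc G" | "y \<in> Cyc G" | "x \<in> cyc_vertices G" "y \<in> cyc_vertices G"
      using xy by (auto simp: cyc_vertices_def)
    then show ?thesis
    proof cases
      case 1
      then have "k x \<in> Cyc H" using h by (auto simp: k_def dest: bij_betwE)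
      then show ?thesis using 1 xy kxy by (auto simp: Cyc_def)
    next
      case 2
      then have "k y \<in> Cyc H" using h by (auto simp: k_def dest: bij_betwE)
      then have "gen_cyclic H (k y) (k x)" "gen_cyclic G y x"
        using 2 xy kxy by (auto simp: Cyc_def)
      then show ?thesis
        using gen_cyclic_sym[of G] gen_cyclic_sym[of H] xy kxy by blast
    next
      case 3
      then have k: "k x = f x" "k y = f y" by (auto simp: k_def cyc_vertices_def)
      \<comment> \<open>\<open>cyc_adj\<close> is false on the diagonal while
        \<open>gen_cyclic\<close> is true there; injectivity reconciles the two.\<close>
      have "f x = f y \<longleftrightarrow> x = y" using 3 f(1) by (auto simp: bij_betw_def dest: inj_onD)
      then show ?thesis
        using f(2)[OF 3] group.gen_cyclic_refl[OF G] group.gen_cyclic_refl[OF H] xy kxy k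
        unfolding cyc_adj_def by metis
    qed
  qed
  then show "\<exists>f. cyc_iso G (carrier G) H (carrier H) f" using bij by (auto simp: cyc_iso_def)
next
  assume "\<exists>f. cyc_iso G (carrier G) H (carrier H) f"
  then obtain f where f: "cyc_iso G (carrier G) H (carrier H) f" by blast
  have inj: "inj_on f (carrier G)" and surj: "f ` carrier G = carrier H"
    using f by (auto simp: cyc_iso_def bij_betw_def)
  have iff: "gen_cyclic G x y \<longleftrightarrow> gen_cyclic H (f x) (f y)" if "x \<in> carrier G" "y \<in> carrier G" for x y
    using f that by (auto simp: cyc_iso_def)
  \<comment> \<open>\<open>Cyc\<close> is determined by the relation \<open>gen_cyclic\<close>
    alone, so \<open>f\<close> respects it.\<close>
  have "cyc_vertices H = f ` cyc_vertices G"
    unfolding cyc_vertices_def Cyc_def surj[symmetric] using iff by auto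
  then have "bij_betw f (cyc_vertices G) (cyc_vertices H)"
    using inj by (auto simp: bij_betw_def cyc_vertices_def intro: inj_on_subset)
  moreover have "cyc_adj G x y \<longleftrightarrow> cyc_adj H (f x) (f y)"
    if "x \<in> cyc_vertices G" "y \<in> cyc_vertices G" for x y
    using that iff inj by (auto simp: cyc_adj_def cyc_vertices_def dest: inj_onD)
  ultimately show "cyclic_graph_iso G H" unfolding cyclic_graph_iso_def by blast
qed

lemma cyclic_graph_iso_subgroup_iff:
  assumes G: "group G" and H: "group H" and P: "subgroup P G" and Q: "subgroup Q H"
    and fin: "finite P" "finite Q" and card: "card P = card Q"
  shows "cyclic_graph_iso (G\<lparr>carrier := P\<rparr>) (H\<lparr>carrier := Q\<rparr>) \<longleftrightarrow> (\<exists>f. cyc_iso G P H Q f)"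
proof -
  have "cyc_iso (G\<lparr>carrier := P\<rparr>) P (H\<lparr>carrier := Q\<rparr>) Q f \<longleftrightarrow> cyc_iso G P H Q f" for f
    using group.gen_cyclic_subgroup[OF G P] group.gen_cyclic_subgroup[OF H Q]
    by (auto simp: cyc_iso_def dest: bij_betwE)
  then show ?thesis
    using cyclic_graph_iso_iff_cyc_iso[of "G\<lparr>carrier := P\<rparr>" "H\<lparr>carrier := Q\<rparr>"] fin card
      subgroup.subgroup_is_group[OF P G] subgroup.subgroup_is_group[OF Q H]
    by (simp add: order_def)
qed

subsection \<open>Nilpotent groups and their Sylow subgroups\<close>

context group
begin

lemma inv_commute:
  assumes "x \<in> carrier G" "y \<in> carrier G" "x \<otimes> y = y \<otimes> x"
  shows "inv x \<otimes> y = y \<otimes> inv x"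
proof -
  have "inv x \<otimes> y = inv x \<otimes> (y \<otimes> x) \<otimes> inv x"
    using assms(1,2) by (simp add: m_assoc)
  also have "\<dots> = inv x \<otimes> (x \<otimes> y) \<otimes> inv x" using assms(3) by simp
  also have "\<dots> = y \<otimes> inv x"
    using assms(1,2) by (simp add: m_assoc[symmetric])
  finally show ?thesis .
qed

lemma commutator_eq_one_iff:
  assumes "x \<in> carrier G" "y \<in> carrier G"
  shows "x \<otimes> y \<otimes> inv x \<otimes> inv y = \<one> \<longleftrightarrow> x \<otimes> y = y \<otimes> x"
proof -
  have "x \<otimes> y \<otimes> inv x \<otimes> inv y = (x \<otimes> y) \<otimes> inv (y \<otimes> x)"
    using assms by (simp add: inv_mult_group m_assoc)
  then show ?thesis using assms
    by (metis inv_closed inv_equality inv_inv m_closed r_inv)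
qed

text \<open>Conjugation is an automorphism. This is used for the normality of the terms of both
  central series.\<close>

lemma conj_commutator:
  assumes "a \<in> carrier G" "x \<in> carrier G" "y \<in> carrier G"
  shows "a \<otimes> (x \<otimes> y \<otimes> inv x \<otimes> inv y) \<otimes> inv a =
    (a \<otimes> x \<otimes> inv a) \<otimes> (a \<otimes> y \<otimes> inv a) \<otimes> inv (a \<otimes> x \<otimes> inv a) \<otimes> inv (a \<otimes> y \<otimes> inv a)"
proof -
  have "inv a \<otimes> (a \<otimes> z) = z" if "z \<in> carrier G" for z
    using that assms by (simp add: m_assoc[symmetric])
  then show ?thesis using assms by (simp add: inv_mult_group m_assoc)
qed

text \<open>If \<open>[x, y] = c\<close> is central, then \<open>[x\<^sup>k, y] = c\<^sup>k = [x, y\<^sup>k]\<close>,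
  so the order of \<open>c\<close> divides both exponents.\<close>

lemma central_commutator_coprime:
  assumes xyc: "x \<in> carrier G" "y \<in> carrier G" "c \<in> carrier G"
    and eq: "x \<otimes> y = c \<otimes> (y \<otimes> x)"
    and cx: "c \<otimes> x = x \<otimes> c" and cy: "c \<otimes> y = y \<otimes> c"
    and m: "x [^] (m::nat) = \<one>" and n: "y [^] (n::nat) = \<one>" and "coprime m n"
  shows "c = \<one>"
proof -
  have xk: "x [^] k \<otimes> y = c [^] k \<otimes> (y \<otimes> x [^] k)" for k :: nat
  proof (induction k)
    case (Suc k)
    have "x [^] Suc k \<otimes> y = x [^] k \<otimes> (c \<otimes> (y \<otimes> x))"
      using xyc eq by (simp add: m_assoc)
    also have "\<dots> = c \<otimes> (x [^] k \<otimes> y) \<otimes> x"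
      using xyc cx group_commutes_pow[of x c k] by (simp add: m_assoc[symmetric])
    also have "\<dots> = c \<otimes> c [^] k \<otimes> (y \<otimes> x [^] k \<otimes> x)"
      using Suc xyc by (simp add: m_assoc)
    also have "\<dots> = c [^] Suc k \<otimes> (y \<otimes> x [^] Suc k)"
      using xyc group_commutes_pow[of c c k] by (simp add: m_assoc)
    finally show ?case .
  qed (use xyc in simp)
  have yk: "x \<otimes> y [^] k = c [^] k \<otimes> (y [^] k \<otimes> x)" for k :: nat
  proof (induction k)
    case (Suc k)
    have yc: "y [^] k \<otimes> c = c \<otimes> y [^] k" using xyc cy group_commutes_pow[of y c k] by simp
    have "x \<otimes> y [^] Suc k = c [^] k \<otimes> (y [^] k \<otimes> x) \<otimes> y"
      using Suc xyc by (simp add: m_assoc[symmetric])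
    also have "\<dots> = c [^] k \<otimes> (y [^] k \<otimes> (c \<otimes> (y \<otimes> x)))"
      using xyc eq by (simp add: m_assoc)
    also have "\<dots> = c [^] k \<otimes> (c \<otimes> y [^] k) \<otimes> (y \<otimes> x)"
      using xyc yc by (simp add: m_assoc[symmetric])
    also have "\<dots> = c [^] Suc k \<otimes> (y [^] Suc k \<otimes> x)"
      using xyc by (simp add: m_assoc)
    finally show ?case .
  qed (use xyc in simp)
  have "c [^] m \<otimes> y = y" "c [^] n \<otimes> x = x"
    using xk[of m] yk[of n] m n xyc by simp_all
  then have "c [^] m = \<one>" "c [^] n = \<one>"
    using xyc by (metis nat_pow_closed l_one r_cancel one_closed)+
  then have "ord c dvd gcd m n" using xyc pow_eq_id by simp
  then show ?thesis using \<open>coprime m n\<close> ord_eq_1 xyc by simp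
qed

end

lemma (in normal) rcos_eq_iff:
  assumes "x \<in> carrier G" "y \<in> carrier G"
  shows "H #> x = H #> y \<longleftrightarrow> x \<otimes> inv y \<in> H"
  using assms is_group rcos_module[OF is_group] rcos_self repr_independence subgroup_axioms by metis

text \<open>The commutator equals \<open>(x \<otimes> y) \<otimes> inv (y \<otimes> x)\<close>, the
  quotient of two elements whose cosets are to agree. Conditions on commutators thus become
  commutation in the factor group.\<close>

lemma (in normal) commutator_mem_iff:
  assumes "x \<in> carrier G" "y \<in> carrier G"
  shows "x \<otimes> y \<otimes> inv x \<otimes> inv y \<in> H \<longleftrightarrow>
    (H #> x) \<otimes>\<^bsub>G Mod H\<^esub> (H #> y) = (H #> y) \<otimes>\<^bsub>G Mod H\<^esub> (H #> x)"
proof -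
  have "x \<otimes> y \<otimes> inv x \<otimes> inv y = (x \<otimes> y) \<otimes> inv (y \<otimes> x)"
    using assms by (simp add: inv_mult_group m_assoc)
  then show ?thesis using assms rcos_eq_iff[of "x \<otimes> y" "y \<otimes> x"] by (simp add: rcos_sum)
qed

section \<open>Lower central series and commuting elements of coprime exponents\<close>

context group
begin

lemma lower_central_normal: "lower_central G n \<lhd> G"
proof (induction n)
  case 0
  then show ?case using normal_self by simp
next
  case (Suc n)
  then interpret N: normal "lower_central G n" G .
  let ?S = "{x \<otimes> y \<otimes> inv x \<otimes> inv y | x y. x \<in> carrier G \<and> y \<in> lower_central G n}"
  have "generate G ?S \<lhd> G"
  proof (rule normal_generateI)
    show "?S \<subseteq> carrier G" using N.subset by auto
  next
    fix h g assume "h \<in> ?S" and g: "g \<in> carrier G"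
    then obtain x y where xy: "x \<in> carrier G" "y \<in> lower_central G n"
      "h = x \<otimes> y \<otimes> inv x \<otimes> inv y" by blast
    then have "g \<otimes> y \<otimes> inv g \<in> lower_central G n" using g N.inv_op_closed2 by blast
    moreover have "g \<otimes> x \<otimes> inv g \<in> carrier G" using g xy by simp
    ultimately show "g \<otimes> h \<otimes> inv g \<in> ?S"
      using conj_commutator[of g x y] xy g N.subset by blast
  qed
  then show ?case by simp
qed

text \<open>The commutator \<open>c\<close> descends through the whole lower central series: once in
  term \<open>i\<close>, it is central modulo term \<open>Suc i\<close>, and coprimality then makes
  it trivial in that quotient. Some term is trivial, so \<open>c\<close> is.\<close>

lemma nilpotent_coprime_commute:
  assumes nil: "nilpotent_group G" and xy: "x \<in> carrier G" "y \<in> carrier G"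
    and "x [^] (m::nat) = \<one>" "y [^] (n::nat) = \<one>" "coprime m n"
  shows "x \<otimes> y = y \<otimes> x"
proof -
  define c where "c = x \<otimes> y \<otimes> inv x \<otimes> inv y"
  have cG: "c \<in> carrier G" using xy by (simp add: c_def)
  have eq: "x \<otimes> y = c \<otimes> (y \<otimes> x)"
  proof -
    have "c = (x \<otimes> y) \<otimes> inv (y \<otimes> x)"
      unfolding c_def using xy by (simp add: m_assoc inv_mult_group)
    then show ?thesis using xy by (metis inv_closed l_inv m_assoc m_closed r_one)
  qed
  have "c \<in> lower_central G i" for i
  proof (induction i)
    case (Suc i)
    interpret N: normal "lower_central G (Suc i)" G by (rule lower_central_normal)
    let ?N = "lower_central G (Suc i)" and ?Q = "G Mod lower_central G (Suc i)"
    interpret Q: group ?Q by (rule N.factorgroup_is_group)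
    have in_Q: "?N #> g \<in> carrier ?Q" if "g \<in> carrier G" for g
      using that by (auto simp: carrier_FactGroup)
    have central: "(?N #> c) \<otimes>\<^bsub>?Q\<^esub> (?N #> g) = (?N #> g) \<otimes>\<^bsub>?Q\<^esub> (?N #> c)"
      if g: "g \<in> carrier G" for g
    proof -
      \<comment> \<open>As \<open>c\<close> is in term \<open>i\<close>, this commutator is one of
        the generators of the next term.\<close>
      have "g \<otimes> c \<otimes> inv g \<otimes> inv c \<in> ?N"
        using Suc g by (auto intro!: generate.incl)
      then show ?thesis using N.commutator_mem_iff[OF g cG] by simp
    qed
    have "?N #> c = \<one>\<^bsub>?Q\<^esub>"
    proof (rule Q.central_commutator_coprime)
      have "?N #> (x \<otimes> y) = ?N #> (c \<otimes> (y \<otimes> x))" using eq by simp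
      then show "(?N #> x) \<otimes>\<^bsub>?Q\<^esub> (?N #> y) = (?N #> c) \<otimes>\<^bsub>?Q\<^esub> ((?N #> y) \<otimes>\<^bsub>?Q\<^esub> (?N #> x))"
        using xy cG by (simp add: N.rcos_sum del: lower_central.simps)
      show "(?N #> x) [^]\<^bsub>?Q\<^esub> m = \<one>\<^bsub>?Q\<^esub>" "(?N #> y) [^]\<^bsub>?Q\<^esub> n = \<one>\<^bsub>?Q\<^esub>"
        using assms N.FactGroup_pow N.subset by (simp_all del: lower_central.simps)
    qed (use in_Q central xy cG \<open>coprime m n\<close> in auto)
    then show "c \<in> ?N"
      using coset_join1[OF _ cG N.subgroup_axioms] by (simp del: lower_central.simps)
  qed (use cG in simp)
  then have "c = \<one>" using nil unfolding nilpotent_group_def by blast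
  then show ?thesis using commutator_eq_one_iff xy c_def by simp
qed

section \<open>Sylow subgroups, torsion and p-groups\<close>

lemma sylow_subgroup_exists:
  assumes "finite (carrier G)" "Factorial_Ring.prime p"
  obtains P where "sylow_subgroup G p P"
proof -
  have "p ^ multiplicity p (order G) dvd order G" by (rule multiplicity_dvd)
  then obtain m where "order G = p ^ multiplicity p (order G) * m" by blast
  then show ?thesis
    using sylow_thm[OF assms(2) is_group] assms(1) that unfolding sylow_subgroup_def by blast
qed

text \<open>By Lagrange, the order of \<open>K\<close> is divisible by every full prime power in the
  order of \<open>G\<close>. This permits checking a property one Sylow subgroup per prime.\<close>

lemma subgroup_eq_carrierI:
  assumes fin: "finite (carrier G)" and K: "subgroup K G"
    and syl: "\<And>p. Factorial_Ring.prime p \<Longrightarrow> \<exists>P. sylow_subgroup G p P \<and> P \<subseteq> K"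
  shows "K = carrier G"
proof -
  have KG: "K \<subseteq> carrier G" using K subgroup.subset by blast
  then have finK: "finite K" using fin finite_subset by blast
  have K0: "card K \<noteq> 0" using finK subgroup.one_closed[OF K] by auto
  have G0: "order G \<noteq> 0" using fin order_gt_0_iff_finite by simp
  have "order G dvd card K"
  proof (rule multiplicity_le_imp_dvd[OF G0])
    fix p :: nat assume p: "Factorial_Ring.prime p"
    then obtain P where P: "sylow_subgroup G p P" "P \<subseteq> K" using syl by blast
    interpret K: group "G\<lparr>carrier := K\<rparr>" using subgroup.subgroup_is_group[OF K is_group] .
    have "subgroup P (G\<lparr>carrier := K\<rparr>)"
      using P K subgroup_incl unfolding sylow_subgroup_def by blast
    from K.lagrange[OF this] have "card P dvd card K"
      unfolding order_def by (simp add: dvdI[of _ _ "card (rcosets\<^bsub>G\<lparr>carrier := K\<rparr>\<^esub> P)"] mult.commute)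
    then show "multiplicity p (order G) \<le> multiplicity p (card K)"
      using P(1) K0 p unfolding sylow_subgroup_def
      by (intro multiplicity_geI) (auto dest: not_prime_unit)
  qed
  then have "card (carrier G) \<le> card K" using K0 by (simp add: order_def dvd_imp_le)
  then show ?thesis using KG fin by (simp add: card_seteq)
qed

lemma subgroup_subset_torsion:
  assumes "finite (carrier G)" "subgroup P G"
  shows "P \<subseteq> torsion G (card P)"
proof
  fix x assume x: "x \<in> P"
  have PG: "P \<subseteq> carrier G" using assms(2) subgroup.subset by blast
  interpret P: group "G\<lparr>carrier := P\<rparr>" using subgroup.subgroup_is_group[OF assms(2) is_group] .
  have "x [^]\<^bsub>G\<lparr>carrier := P\<rparr>\<^esub> card P = \<one>"
    using P.pow_order_eq_1[of x] x by (simp add: order_def)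
  then show "x \<in> torsion G (card P)"
    using x PG nat_pow_consistent[of x "card P" P] by (auto simp: torsion_def)
qed

text \<open>If \<open>y\<close> has exponent \<open>card P\<close>, its power by the index of
  \<open>P\<close> also lies in \<open>P\<close>. These two exponents are coprime, so Bezout
  recovers \<open>y\<close> inside \<open>P\<close>.\<close>

lemma normal_sylow_eq_torsion:
  assumes fin: "finite (carrier G)" and p: "Factorial_Ring.prime p" and P: "sylow_subgroup G p P"
    and normal: "P \<lhd> G"
  shows "P = torsion G (card P)"
proof
  interpret normal P G by (rule normal)
  show "P \<subseteq> torsion G (card P)" using subgroup_subset_torsion fin subgroup_axioms by blast
  interpret Q: group "G Mod P" by (rule factorgroup_is_group)
  have idx: "order (G Mod P) * card P = order G"
    using lagrange[OF subgroup_axioms] by (simp add: order_def FactGroup_def)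
  have G0: "order G \<noteq> 0" using fin order_gt_0_iff_finite by simp
  have "\<not> p dvd order (G Mod P)"
  proof
    assume "p dvd order (G Mod P)"
    then have "p ^ Suc (multiplicity p (order G)) dvd order G"
      using idx P unfolding sylow_subgroup_def by (metis mult_dvd_mono power_Suc dvd_refl)
    then show False
      using G0 p by (metis Suc_n_not_le_n multiplicity_geI not_prime_unit)
  qed
  then have cop: "coprime (int (card P)) (int (order (G Mod P)))"
    using p P unfolding sylow_subgroup_def
    by (simp add: prime_imp_coprime coprime_commute)
  show "torsion G (card P) \<subseteq> P"
  proof
    fix y assume y: "y \<in> torsion G (card P)"
    then have yG: "y \<in> carrier G" and y1: "y [^] card P = \<one>" by (auto simp: torsion_def)
    have "(P #> y) [^]\<^bsub>G Mod P\<^esub> order (G Mod P) = \<one>\<^bsub>G Mod P\<^esub>"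
      using Q.pow_order_eq_1[of "P #> y"] yG by (simp add: carrier_FactGroup)
    then have y2: "y [^] order (G Mod P) \<in> P"
      using FactGroup_pow[OF yG] coset_join1[OF _ _ subgroup_axioms] yG by simp
    obtain u v where uv: "u * int (card P) + v * int (order (G Mod P)) = 1"
      using cop bezout_int[of "int (card P)" "int (order (G Mod P))"] by auto
    have "y = y [^] (u * int (card P) + v * int (order (G Mod P)))"
      using uv yG by simp
    also have "\<dots> = (y [^] card P) [^] u \<otimes> (y [^] order (G Mod P)) [^] v"
      using yG by (simp add: int_pow_mult int_pow_pow mult.commute flip: int_pow_int)
    also have "\<dots> \<in> P"
      using y1 y2 subgroup_int_pow_closed[OF subgroup_axioms] by simp
    finally show "y \<in> P" .
  qed
qed

text \<open>The normalizer of a Sylow subgroup of a nilpotent group contains all Sylow subgroups for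
  other primes, because these centralize it.\<close>

lemma nilpotent_sylow_eq_torsion:
  assumes nil: "nilpotent_group G" and fin: "finite (carrier G)" and p: "Factorial_Ring.prime p"
    and P: "sylow_subgroup G p P"
  shows "P = torsion G (p ^ multiplicity p (order G))"
proof -
  have sP: "subgroup P G" and cP: "card P = p ^ multiplicity p (order G)"
    using P by (auto simp: sylow_subgroup_def)
  have PG: "P \<subseteq> carrier G" using sP subgroup.subset by blast
  \<comment> \<open>The normalizer of \<open>P\<close>, with conjugation required in both directions
    so that closure under inverses is immediate.\<close>
  define K where "K = {g \<in> carrier G. \<forall>x\<in>P. g \<otimes> x \<otimes> inv g \<in> P \<and> inv g \<otimes> x \<otimes> g \<in> P}"
  have sK: "subgroup K G"
  proof (rule subgroupI)
    show "K \<subseteq> carrier G" by (auto simp: K_def)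
    show "K \<noteq> {}" using PG by (auto simp: K_def intro!: exI[of _ \<one>])
    show "inv a \<in> K" if "a \<in> K" for a using that by (auto simp: K_def)
    show "a \<otimes> b \<in> K" if "a \<in> K" "b \<in> K" for a b
    proof -
      have "a \<otimes> b \<otimes> x \<otimes> inv (a \<otimes> b) = a \<otimes> (b \<otimes> x \<otimes> inv b) \<otimes> inv a"
        "inv (a \<otimes> b) \<otimes> x \<otimes> (a \<otimes> b) = inv b \<otimes> (inv a \<otimes> x \<otimes> a) \<otimes> b" if "x \<in> P" for x
        using that PG \<open>a \<in> K\<close> \<open>b \<in> K\<close> by (auto simp: K_def inv_mult_group m_assoc subset_iff)
      then show ?thesis using that by (simp add: K_def)
    qed
  qed
  have "K = carrier G"
  proof (rule subgroup_eq_carrierI[OF fin sK])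
    fix q :: nat assume q: "Factorial_Ring.prime q"
    show "\<exists>Q. sylow_subgroup G q Q \<and> Q \<subseteq> K"
    proof (cases "q = p")
      case True
      have "P \<subseteq> K"
        using sP PG by (auto simp: K_def subgroup.m_closed subgroup.m_inv_closed)
      then show ?thesis using P True by blast
    next
      case False
      obtain Q where Q: "sylow_subgroup G q Q" using sylow_subgroup_exists fin q by blast
      then have tQ: "Q \<subseteq> torsion G (card Q)" and tP: "P \<subseteq> torsion G (card P)"
        using subgroup_subset_torsion[OF fin] sP unfolding sylow_subgroup_def by blast+
      have cop: "coprime (card Q) (card P)"
        using Q cP False p q by (simp add: sylow_subgroup_def primes_coprime)
      have "Q \<subseteq> K"
      proof
        fix g assume g: "g \<in> Q"
        then have gG: "g \<in> carrier G" using tQ by (auto simp: torsion_def)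
        have "g \<otimes> x \<otimes> inv g = x \<and> inv g \<otimes> x \<otimes> g = x" if x: "x \<in> P" for x
        proof -
          have xG: "x \<in> carrier G" using x PG by auto
          have gx: "g \<otimes> x = x \<otimes> g"
            using nilpotent_coprime_commute[OF nil gG xG _ _ cop] g x tQ tP
            by (auto simp: torsion_def)
          have "g \<otimes> x \<otimes> inv g = x" using gx gG xG by (simp add: m_assoc)
          moreover have "inv g \<otimes> x \<otimes> g = x"
            using gx gG xG by (metis inv_closed l_inv l_one m_assoc)
          ultimately show ?thesis by blast
        qed
        then show "g \<in> K" using gG by (simp add: K_def)
      qed
      then show ?thesis using Q by blast
    qed
  qed
  then have "P \<lhd> G" using sP unfolding normal_inv_iff by (auto simp: K_def)
  then show ?thesis using normal_sylow_eq_torsion[OF fin p P] cP by simp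
qed

text \<open>Class equation: were the identity the only central element, every other conjugacy class
  would have size a nontrivial power of \<open>p\<close>, and \<open>p ^ k\<close> would be 1 modulo
  \<open>p\<close>.\<close>

lemma p_group_center_nontrivial:
  assumes p: "Factorial_Ring.prime p" and ord: "order G = p ^ k" and k: "k > 0"
  obtains z where "z \<in> carrier G" "z \<noteq> \<one>" "\<And>g. g \<in> carrier G \<Longrightarrow> g \<otimes> z = z \<otimes> g"
proof (rule ccontr)
  note witness = that
  assume "\<not> thesis"
  then have nc: "\<exists>g\<in>carrier G. g \<otimes> z \<noteq> z \<otimes> g" if "z \<in> carrier G" "z \<noteq> \<one>" for z
    using that witness by blast
  have fin: "finite (carrier G)"
    using ord p order_gt_0_iff_finite by (simp add: prime_gt_0_nat)
  define \<phi> where "\<phi> = (\<lambda>g. \<lambda>h \<in> carrier G. g \<otimes> h \<otimes> inv g)"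
  interpret A: group_action G "carrier G" \<phi>
    unfolding \<phi>_def by (rule action_by_conjugation)
  let ?O = "orbits G (carrier G) \<phi>"
  have finO: "finite ?O" using fin by (simp add: orbits_def)
  have orb1: "orbit G \<phi> \<one> = {\<one>}" by (auto simp: orbit_def \<phi>_def intro!: exI[of _ \<one>])
  then have oneO: "{\<one>} \<in> ?O" by (auto simp: orbits_def)
  have div: "p dvd card B" if B: "B \<in> ?O - {{\<one>}}" for B
  proof -
    obtain x where x: "x \<in> carrier G" "B = orbit G \<phi> x" using B by (auto simp: orbits_def)
    then have "x \<noteq> \<one>" using B orb1 by auto
    then obtain g where g: "g \<in> carrier G" "g \<otimes> x \<noteq> x \<otimes> g" using nc x(1) by blast
    have "g \<otimes> x \<otimes> inv g \<in> B" using g x by (auto simp: orbit_def \<phi>_def)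
    moreover have "x \<in> B" using A.orbit_refl x by blast
    moreover have "g \<otimes> x \<otimes> inv g \<noteq> x"
      using g x by (metis inv_closed inv_solve_right m_closed)
    ultimately have "card B \<noteq> 1" by (metis card_1_singletonE singletonD)
    moreover have "card B dvd p ^ k"
      using A.orbit_stabilizer_theorem[OF x(1)] x(2) ord by (metis dvd_triv_left)
    ultimately show ?thesis using p by (metis divides_primepow_nat dvd_power gr0I power_0)
  qed
  have "p ^ k = (\<Sum>B\<in>?O. card B)"
    using A.disjoint_sum[OF fin, of "\<lambda>_. 1::nat"] ord by (simp add: order_def)
  also have "\<dots> = 1 + (\<Sum>B\<in>?O - {{\<one>}}. card B)"
    using finO oneO by (simp add: sum.remove)
  finally have "p dvd 1 + (\<Sum>B\<in>?O - {{\<one>}}. card B)" using k by (metis dvd_power)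
  moreover have "p dvd (\<Sum>B\<in>?O - {{\<one>}}. card B)" using div by (rule dvd_sum)
  ultimately have "p dvd 1" using dvd_add_left_iff by blast
  then show False using p by (simp add: not_prime_unit)
qed

text \<open>The quotient of \<open>P\<close> by \<open>Z \<inter> P\<close> is a nontrivial p-group;
  \<open>x\<close> lifts a nontrivial element of its center.\<close>

lemma p_subgroup_central_mod_normal:
  assumes fin: "finite (carrier G)" and p: "Factorial_Ring.prime p" and P: "subgroup P G" and card: "card P = p ^ k"
    and Z: "Z \<lhd> G" and nsub: "\<not> P \<subseteq> Z"
  obtains x where "x \<in> P" "x \<notin> Z" "\<And>g. g \<in> P \<Longrightarrow> g \<otimes> x \<otimes> inv g \<otimes> inv x \<in> Z"
proof -
  let ?L = "G\<lparr>carrier := P\<rparr>"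
  let ?W = "Z \<inter> P"
  interpret L: group ?L using subgroup.subgroup_is_group[OF P is_group] .
  interpret W: normal ?W ?L using normal_Int_subgroup[OF P Z] .
  let ?Q = "?L Mod ?W"
  interpret Q: group ?Q by (rule W.factorgroup_is_group)
  have idx: "order ?Q * card ?W = p ^ k"
    using L.lagrange[OF W.subgroup_axioms] card by (simp add: order_def FactGroup_def)
  then have "order ?Q dvd p ^ k" by (metis dvd_triv_left)
  then obtain j where j: "order ?Q = p ^ j" using p divides_primepow_nat by blast
  have "j \<noteq> 0"
  proof
    assume "j = 0"
    then have "card ?W = card P" using idx j card by simp
    then have "?W = P"
      using fin P by (metis Int_lower2 card_subset_eq finite_subset subgroup.subset)
    then show False using nsub by blast
  qed
  then obtain z where z: "z \<in> carrier ?Q" "z \<noteq> \<one>\<^bsub>?Q\<^esub>"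
    "\<And>g. g \<in> carrier ?Q \<Longrightarrow> g \<otimes>\<^bsub>?Q\<^esub> z = z \<otimes>\<^bsub>?Q\<^esub> g"
    using Q.p_group_center_nontrivial[OF p j] by blast
  obtain x where x: "x \<in> P" "z = ?W #>\<^bsub>?L\<^esub> x" using z(1) by (auto simp: carrier_FactGroup)
  have "x \<notin> Z"
  proof
    assume "x \<in> Z"
    then have "?W #>\<^bsub>?L\<^esub> x = ?W"
      using L.coset_join2[OF _ W.subgroup_axioms, of x] x(1) by simp
    then show False using z(2) x(2) by simp
  qed
  moreover have "g \<otimes> x \<otimes> inv g \<otimes> inv x \<in> Z" if g: "g \<in> P" for g
  proof -
    have "?W #>\<^bsub>?L\<^esub> g \<in> carrier ?Q" using g by (auto simp: carrier_FactGroup)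
    then have "g \<otimes>\<^bsub>?L\<^esub> x \<otimes>\<^bsub>?L\<^esub> inv\<^bsub>?L\<^esub> g \<otimes>\<^bsub>?L\<^esub> inv\<^bsub>?L\<^esub> x \<in> ?W"
      using W.commutator_mem_iff[of g x] z(3) g x by simp
    then show ?thesis using m_inv_consistent[OF P] g x(1) by simp
  qed
  ultimately show ?thesis using that x(1) by blast
qed

end

section \<open>Upper central series and a criterion for nilpotency\<close>

fun upper_central :: "('a, 'b) monoid_scheme \<Rightarrow> nat \<Rightarrow> 'a set" where
  "upper_central G 0 = {\<one>\<^bsub>G\<^esub>}"
| "upper_central G (Suc n) = {x \<in> carrier G. \<forall>g\<in>carrier G.
     g \<otimes>\<^bsub>G\<^esub> x \<otimes>\<^bsub>G\<^esub> inv\<^bsub>G\<^esub> g \<otimes>\<^bsub>G\<^esub> inv\<^bsub>G\<^esub> x \<in> upper_central G n}"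

context group
begin

text \<open>This set is the preimage of the centralizer of the image of \<open>S\<close> in
  \<open>G Mod Z\<close>. Taking \<open>S\<close> as the carrier gives the next term of the upper
  central series; a singleton \<open>S\<close> is used in the nilpotency criterion.\<close>

lemma subgroup_centralizer_mod_normal:
  assumes Z: "Z \<lhd> G" and S: "S \<subseteq> carrier G"
  shows "subgroup {x \<in> carrier G. \<forall>g\<in>S. g \<otimes> x \<otimes> inv g \<otimes> inv x \<in> Z} G" (is "subgroup ?C G")
proof -
  interpret Z: normal Z G by (rule Z)
  let ?Q = "G Mod Z"
  interpret Q: group ?Q by (rule Z.factorgroup_is_group)
  have in_Q: "Z #> g \<in> carrier ?Q" if "g \<in> carrier G" for g
    using that by (auto simp: carrier_FactGroup)
  have mult: "Z #> (g \<otimes> h) = (Z #> g) \<otimes>\<^bsub>?Q\<^esub> (Z #> h)" if "g \<in> carrier G" "h \<in> carrier G" for g h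
    using that by (simp add: Z.rcos_sum)
  have inv: "Z #> inv g = inv\<^bsub>?Q\<^esub> (Z #> g)" if "g \<in> carrier G" for g
    using that in_Q Z.inv_FactGroup Z.rcos_inv by simp
  have C: "x \<in> ?C \<longleftrightarrow> x \<in> carrier G \<and>
      (\<forall>g\<in>S. (Z #> x) \<otimes>\<^bsub>?Q\<^esub> (Z #> g) = (Z #> g) \<otimes>\<^bsub>?Q\<^esub> (Z #> x))" for x
    using Z.commutator_mem_iff[of _ x] S by (auto simp: subset_iff)
  show ?thesis
  proof (rule subgroupI)
    show "?C \<subseteq> carrier G" by auto
    have "\<one> \<in> ?C" using S Z.one_closed by auto
    then show "?C \<noteq> {}" by blast
  next
    fix a assume "a \<in> ?C"
    then have "a \<in> carrier G" "\<And>g. g \<in> S \<Longrightarrow> (Z #> a) \<otimes>\<^bsub>?Q\<^esub> (Z #> g) = (Z #> g) \<otimes>\<^bsub>?Q\<^esub> (Z #> a)"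
      using C by blast+
    then show "inv a \<in> ?C"
      unfolding C using Q.inv_commute[OF in_Q in_Q] S inv by (simp add: subset_iff)
  next
    fix a b assume "a \<in> ?C" "b \<in> ?C"
    then have ab: "a \<in> carrier G" "b \<in> carrier G"
      "\<And>g. g \<in> S \<Longrightarrow> (Z #> a) \<otimes>\<^bsub>?Q\<^esub> (Z #> g) = (Z #> g) \<otimes>\<^bsub>?Q\<^esub> (Z #> a)"
      "\<And>g. g \<in> S \<Longrightarrow> (Z #> b) \<otimes>\<^bsub>?Q\<^esub> (Z #> g) = (Z #> g) \<otimes>\<^bsub>?Q\<^esub> (Z #> b)"
      using C by blast+
    have "(Z #> (a \<otimes> b)) \<otimes>\<^bsub>?Q\<^esub> (Z #> g) = (Z #> g) \<otimes>\<^bsub>?Q\<^esub> (Z #> (a \<otimes> b))" if g: "g \<in> S" for g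
    proof -
      have Q: "Z #> a \<in> carrier ?Q" "Z #> b \<in> carrier ?Q" "Z #> g \<in> carrier ?Q"
        using in_Q ab g S by auto
      have "(Z #> (a \<otimes> b)) \<otimes>\<^bsub>?Q\<^esub> (Z #> g) = (Z #> a) \<otimes>\<^bsub>?Q\<^esub> ((Z #> b) \<otimes>\<^bsub>?Q\<^esub> (Z #> g))"
        unfolding mult[OF ab(1,2)] by (rule Q.m_assoc[OF Q])
      also have "\<dots> = (Z #> a) \<otimes>\<^bsub>?Q\<^esub> (Z #> g) \<otimes>\<^bsub>?Q\<^esub> (Z #> b)"
        unfolding ab(4)[OF g] by (rule Q.m_assoc[OF Q(1,3,2), symmetric])
      also have "\<dots> = (Z #> g) \<otimes>\<^bsub>?Q\<^esub> (Z #> (a \<otimes> b))"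
        unfolding ab(3)[OF g] mult[OF ab(1,2)] by (rule Q.m_assoc[OF Q(3,1,2)])
      finally show ?thesis .
    qed
    then show "a \<otimes> b \<in> ?C" unfolding C using ab by simp
  qed
qed

lemma upper_central_normal: "upper_central G n \<lhd> G"
proof (induction n)
  case 0
  then show ?case using one_is_normal by simp
next
  case (Suc n)
  then interpret Z: normal "upper_central G n" G .
  show ?case unfolding normal_inv_iff
  proof (intro conjI ballI)
    show "subgroup (upper_central G (Suc n)) G"
      using subgroup_centralizer_mod_normal[OF Suc, of "carrier G"] by simp
  next
    fix a x assume a: "a \<in> carrier G" and x: "x \<in> upper_central G (Suc n)"
    then have xG: "x \<in> carrier G" by simp
    have "g \<otimes> (a \<otimes> x \<otimes> inv a) \<otimes> inv g \<otimes> inv (a \<otimes> x \<otimes> inv a) \<in> upper_central G n"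
      if g: "g \<in> carrier G" for g
    proof -
      \<comment> \<open>Chosen so that the commutator of \<open>g\<close> with the conjugate of
        \<open>x\<close> is the conjugate of the commutator of \<open>?h\<close> with
        \<open>x\<close>.\<close>
      let ?h = "inv a \<otimes> g \<otimes> a"
      have "a \<otimes> ?h \<otimes> inv a = (a \<otimes> inv a) \<otimes> g \<otimes> (a \<otimes> inv a)"
        using a g by (simp only: m_assoc m_closed inv_closed)
      then have "a \<otimes> ?h \<otimes> inv a = g" using a g by simp
      then have "g \<otimes> (a \<otimes> x \<otimes> inv a) \<otimes> inv g \<otimes> inv (a \<otimes> x \<otimes> inv a) =
          a \<otimes> (?h \<otimes> x \<otimes> inv ?h \<otimes> inv x) \<otimes> inv a"
        using conj_commutator[of a ?h x] a g xG by simp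
      moreover have "?h \<otimes> x \<otimes> inv ?h \<otimes> inv x \<in> upper_central G n" using x a g by simp
      ultimately show ?thesis using a Z.inv_op_closed2 by simp
    qed
    then show "a \<otimes> x \<otimes> inv a \<in> upper_central G (Suc n)" using a xG by simp
  qed
qed

lemma upper_central_subset_Suc: "upper_central G n \<subseteq> upper_central G (Suc n)"
proof
  interpret Z: normal "upper_central G n" G by (rule upper_central_normal)
  fix x assume x: "x \<in> upper_central G n"
  then have "g \<otimes> x \<otimes> inv g \<otimes> inv x \<in> upper_central G n" if "g \<in> carrier G" for g
    using that Z.inv_op_closed2 Z.m_closed Z.m_inv_closed by blast
  then show "x \<in> upper_central G (Suc n)" using x Z.subset by auto
qed

text \<open>The two series run against each other: term \<open>i\<close> of the lower one lies in
  term \<open>n - i\<close> of the upper one, so term \<open>n\<close> of the lower one is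
  trivial.\<close>

lemma upper_central_imp_nilpotent:
  assumes "upper_central G n = carrier G"
  shows "nilpotent_group G"
proof -
  have "lower_central G i \<subseteq> upper_central G (n - i)" if "i \<le> n" for i
    using that
  proof (induction i)
    case 0
    then show ?case using assms by simp
  next
    case (Suc i)
    interpret Z: normal "upper_central G (n - Suc i)" G by (rule upper_central_normal)
    have "lower_central G i \<subseteq> upper_central G (Suc (n - Suc i))"
      using Suc by (simp add: Suc_diff_Suc del: upper_central.simps)
    then have "{x \<otimes> y \<otimes> inv x \<otimes> inv y | x y. x \<in> carrier G \<and> y \<in> lower_central G i}
        \<subseteq> upper_central G (n - Suc i)"
      by auto
    then show ?case
      using generate_subgroup_incl Z.subgroup_axioms by simp
  qed
  from this[of n] have "lower_central G n \<subseteq> {\<one>}" by simp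
  moreover have "\<one> \<in> lower_central G n"
    using lower_central_normal normal_imp_subgroup subgroup.one_closed by blast
  ultimately show ?thesis using is_group by (auto simp: nilpotent_group_def)
qed

lemma torsion_conj_closed:
  assumes "x \<in> torsion G n" "g \<in> carrier G"
  shows "g \<otimes> x \<otimes> inv g \<in> torsion G n"
proof -
  have x: "x \<in> carrier G" "x [^] n = \<one>" using assms by (auto simp: torsion_def)
  have "(g \<otimes> x \<otimes> inv g) [^] k = g \<otimes> x [^] k \<otimes> inv g" for k :: nat
  proof (induction k)
    case (Suc k)
    have "inv g \<otimes> (g \<otimes> z) = z" if "z \<in> carrier G" for z
      using that assms(2) by (simp add: m_assoc[symmetric])
    then show ?case using Suc x assms(2) by (simp add: m_assoc)
  qed (use assms in simp)
  then show ?thesis using x assms(2) by (simp add: torsion_def)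
qed

text \<open>The upper central series grows strictly as long as it has not reached the finite group
  \<open>G\<close>, so it reaches it.\<close>

lemma torsion_sylow_imp_nilpotent:
  assumes fin: "finite (carrier G)"
    and syl: "\<And>p. Factorial_Ring.prime p \<Longrightarrow> sylow_subgroup G p (torsion G (p ^ multiplicity p (order G)))"
  shows "nilpotent_group G"
proof -
  let ?S = "\<lambda>p. torsion G (p ^ multiplicity p (order G))"
  have sub: "subgroup (?S p) G" and card: "card (?S p) = p ^ multiplicity p (order G)"
    if "Factorial_Ring.prime p" for p
    using syl[OF that] by (auto simp: sylow_subgroup_def)
  have normal: "?S p \<lhd> G" if "Factorial_Ring.prime p" for p
    unfolding normal_inv_iff using sub[OF that] torsion_conj_closed by blast
  \<comment> \<open>The commutator lies in two normal Sylow subgroups for different primes, so its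
    order divides coprime numbers.\<close>
  have commute: "x \<otimes> y \<otimes> inv x \<otimes> inv y = \<one>"
    if pq: "Factorial_Ring.prime p" "Factorial_Ring.prime q" "p \<noteq> q" and x: "x \<in> ?S p" and y: "y \<in> ?S q" for p q x y
  proof -
    have xy: "x \<in> carrier G" "y \<in> carrier G" using x y by (simp_all add: torsion_def)
    interpret P: normal "?S p" G using normal pq by blast
    interpret Q: normal "?S q" G using normal pq by blast
    let ?c = "x \<otimes> y \<otimes> inv x \<otimes> inv y"
    have "?c = x \<otimes> (y \<otimes> inv x \<otimes> inv y)" using xy by (simp add: m_assoc)
    moreover have "x \<otimes> (y \<otimes> inv x \<otimes> inv y) \<in> ?S p"
      by (intro P.m_closed[OF x] P.inv_op_closed2[OF xy(2)] P.m_inv_closed[OF x])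
    ultimately have "?c \<in> ?S p" by (rule ssubst)
    moreover have "?c \<in> ?S q"
      by (intro Q.m_closed Q.inv_op_closed2[OF xy(1) y] Q.m_inv_closed[OF y])
    ultimately have "ord ?c dvd p ^ multiplicity p (order G)" "ord ?c dvd q ^ multiplicity q (order G)"
      using pow_eq_id[of ?c] xy unfolding torsion_def by simp_all
    moreover have "coprime (p ^ multiplicity p (order G)) (q ^ multiplicity q (order G))"
      using pq by (simp add: primes_coprime)
    ultimately have "ord ?c = 1" by (meson coprime_common_divisor_nat)
    then show ?thesis using ord_eq_1 xy by simp
  qed
  \<comment> \<open>Some Sylow subgroup is not inside \<open>?Z\<close> and contributes an element
    \<open>x\<close> outside \<open>?Z\<close> that is central modulo \<open>?Z\<close> within it.
    The Sylow subgroups for other primes commute with \<open>x\<close> outright, so \<open>x\<close>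
    belongs to the next term.\<close>
  have grow: "upper_central G n \<subset> upper_central G (Suc n)" if n: "upper_central G n \<noteq> carrier G" for n
  proof -
    let ?Z = "upper_central G n"
    interpret Z: normal ?Z G by (rule upper_central_normal)
    obtain p where p: "Factorial_Ring.prime p" "\<not> ?S p \<subseteq> ?Z"
      using subgroup_eq_carrierI[OF fin Z.subgroup_axioms] syl n by blast
    obtain x where x: "x \<in> ?S p" "x \<notin> ?Z" "\<And>g. g \<in> ?S p \<Longrightarrow> g \<otimes> x \<otimes> inv g \<otimes> inv x \<in> ?Z"
      using p_subgroup_central_mod_normal[OF fin p(1) sub[OF p(1)] card[OF p(1)] upper_central_normal p(2)]
      by blast
    have xG: "x \<in> carrier G" using x(1) by (simp add: torsion_def)
    let ?C = "{g \<in> carrier G. \<forall>h\<in>{x}. h \<otimes> g \<otimes> inv h \<otimes> inv g \<in> ?Z}"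
    have swap: "x \<otimes> g \<otimes> inv x \<otimes> inv g \<in> ?Z \<longleftrightarrow> g \<otimes> x \<otimes> inv g \<otimes> inv x \<in> ?Z"
      if "g \<in> carrier G" for g
      using Z.commutator_mem_iff[OF that xG] Z.commutator_mem_iff[OF xG that] by auto
    have "?C = carrier G"
    proof (rule subgroup_eq_carrierI[OF fin])
      show "subgroup ?C G" using xG by (intro subgroup_centralizer_mod_normal upper_central_normal) simp
      fix q :: nat assume q: "Factorial_Ring.prime q"
      have "g \<otimes> x \<otimes> inv g \<otimes> inv x \<in> ?Z" if g: "g \<in> ?S q" for g
      proof (cases "q = p")
        case True
        then show ?thesis using x(3) g by blast
      next
        case False
        then show ?thesis using commute[OF q p(1) False g x(1)] Z.one_closed by simp
      qed
      moreover have "?S q \<subseteq> carrier G" by (auto simp: torsion_def)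
      ultimately have "?S q \<subseteq> ?C" using swap by blast
      then show "\<exists>P. sylow_subgroup G q P \<and> P \<subseteq> ?C" using syl[OF q] by blast
    qed
    then have "x \<in> upper_central G (Suc n)" using swap xG by auto
    then show ?thesis using upper_central_subset_Suc x(2) by blast
  qed
  have "\<exists>n. upper_central G n = carrier G"
  proof (rule ccontr)
    assume "\<nexists>n. upper_central G n = carrier G"
    then have less: "upper_central G n \<subset> upper_central G (Suc n)" for n using grow by blast
    have finZ: "finite (upper_central G n)" and cardZ: "card (upper_central G n) \<le> order G" for n
      using fin subgroup.subset[OF normal_imp_subgroup[OF upper_central_normal[of n]]]
      by (auto simp: order_def intro: finite_subset card_mono)
    \<comment> \<open>Each strict inclusion adds at least one element, which exceeds the bound
      \<open>order G\<close> at stage \<open>Suc (order G)\<close>.\<close>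
    have "n \<le> card (upper_central G n)" for n
    proof (induction n)
      case (Suc n)
      then show ?case using psubset_card_mono[OF finZ less[of n]] by linarith
    qed simp
    then show False using cardZ[of "Suc (order G)"] by (metis Suc_n_not_le_n order_trans)
  qed
  then show ?thesis using upper_central_imp_nilpotent by blast
qed

end

subsection \<open>Gluing along coprime torsion\<close>

context group
begin

lemma torsion_int_pow:
  assumes "x \<in> torsion G m"
  shows "x [^] (k * int m) = \<one>"
proof -
  have "x [^] (int m * k) = (x [^] int m) [^] k"
    using assms int_pow_pow[of x "int m" k] by (simp add: torsion_def)
  then show ?thesis using assms by (simp add: torsion_def int_pow_int mult.commute)
qed

lemma torsion_pow_eq_self:
  assumes "x \<in> torsion G m" "k + l * int m = 1"
  shows "x [^] k = x"
proof -
  have xG: "x \<in> carrier G" using assms by (simp add: torsion_def)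
  have "x [^] (k + l * int m) = x [^] k"
    using int_pow_mult[OF xG, of k "l * int m"] torsion_int_pow[OF assms(1), of l] xG by simp
  then show ?thesis using assms(2) xG by simp
qed

lemma torsion_mult_int_pow:
  assumes "x \<in> torsion G (m * n)"
  shows "x [^] (k * int n) \<in> torsion G m"
proof -
  have xG: "x \<in> carrier G" using assms by (simp add: torsion_def)
  have "(x [^] (k * int n)) [^] int m = x [^] (k * int (m * n))"
    using int_pow_pow[OF xG, of "k * int n" "int m"] by (simp add: ac_simps)
  then have "(x [^] (k * int n)) [^] m = \<one>"
    using torsion_int_pow[OF assms, of k] by (simp add: int_pow_int)
  then show ?thesis using xG by (simp add: torsion_def)
qed

text \<open>A common generator may have too large an order. The Bezout generator is a product of
  powers of \<open>x\<close> and \<open>y\<close> and commutes with both, so it inherits the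
  exponent \<open>k\<close>.\<close>

lemma gen_cyclic_torsion_bezout:
  assumes "x \<in> torsion G k" "y \<in> torsion G k" "gen_cyclic G x y"
  obtains c and i j :: int where "c \<in> torsion G k" "x = c [^] i" "y = c [^] j"
proof -
  have xy: "x \<in> carrier G" "y \<in> carrier G" using assms by (simp_all add: torsion_def)
  obtain c and i j s t :: int where c: "c \<in> carrier G" "x = c [^] i" "y = c [^] j"
    "c = x [^] s \<otimes> y [^] t"
    using gen_cyclic_iff_bezout[OF xy] assms(3) by blast
  have "x [^] s \<otimes> y [^] t = c [^] (i * s + j * t)"
    using c(1-3) by (simp add: int_pow_pow int_pow_mult)
  then have "c = c [^] (i * s + j * t)" using c(4) by simp
  then have "c [^] int k = c [^] ((i * int k) * s + (j * int k) * t)"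
    using int_pow_pow[OF c(1), of "i * s + j * t" "int k"] by (simp add: algebra_simps)
  also have "\<dots> = (x [^] int k) [^] s \<otimes> (y [^] int k) [^] t"
    using c(1-3) by (simp add: int_pow_pow int_pow_mult)
  also have "\<dots> = \<one>" using assms(1,2) by (simp add: int_pow_int torsion_def)
  finally have "c \<in> torsion G k" using c(1) by (simp add: torsion_def int_pow_int)
  then show ?thesis using that c by blast
qed

context
  fixes m n :: nat and u v :: int
  assumes nil: "nilpotent_group G" and uv: "u * int m + v * int n = 1"
begin

lemma coprime_torsion_commute:
  assumes x: "x \<in> torsion G m" and y: "y \<in> torsion G n"
  shows "x \<otimes> y = y \<otimes> x"
proof -
  have "coprime (int m) (int n)"
    using uv by (metis coprimeI dvd_add dvd_mult)
  then have "coprime m n" by simp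
  then show ?thesis
    using nilpotent_coprime_commute[OF nil, of x y m n] x y by (simp add: torsion_def)
qed

text \<open>The exponent \<open>v * int n\<close> is 1 modulo \<open>m\<close> and 0 modulo
  \<open>n\<close>, and \<open>u * int m\<close> the reverse. They project a product of commuting
  torsion elements to its two components.\<close>

lemma torsion_mult_split:
  assumes x: "x \<in> torsion G m" and y: "y \<in> torsion G n"
  shows "(x \<otimes> y) [^] (v * int n) = x" "(x \<otimes> y) [^] (u * int m) = y"
proof -
  have xy: "x \<in> carrier G" "y \<in> carrier G" using x y by (simp_all add: torsion_def)
  have dist: "(x \<otimes> y) [^] k = x [^] k \<otimes> y [^] k" for k :: int
    by (rule int_pow_mult_distrib[OF coprime_torsion_commute[OF x y] xy])
  show "(x \<otimes> y) [^] (v * int n) = x"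
    using dist torsion_int_pow[OF y, of v] torsion_pow_eq_self[OF x, of "v * int n" u] uv xy
    by (simp add: add.commute)
  show "(x \<otimes> y) [^] (u * int m) = y"
    using dist torsion_int_pow[OF x, of u] torsion_pow_eq_self[OF y, of "u * int m" v] uv xy
    by simp
qed

lemma torsion_split_prod:
  assumes "x \<in> carrier G"
  shows "x [^] (v * int n) \<otimes> x [^] (u * int m) = x"
  using int_pow_mult[OF assms, of "v * int n" "u * int m", symmetric] uv assms
  by (simp add: add.commute)

text \<open>The inverse is multiplication; commutation of coprime torsion makes the product have
  exponent \<open>m * n\<close>.\<close>

lemma bij_betw_torsion_split:
  "bij_betw (\<lambda>x. (x [^] (v * int n), x [^] (u * int m))) (torsion G (m * n)) (torsion G m \<times> torsion G n)"
proof (rule bij_betw_byWitness[where f' = "\<lambda>(x, y). x \<otimes> y"])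
  show "\<forall>x\<in>torsion G (m * n). (case (x [^] (v * int n), x [^] (u * int m)) of (x, y) \<Rightarrow> x \<otimes> y) = x"
    using torsion_split_prod by (simp add: torsion_def)
  show "\<forall>a'\<in>torsion G m \<times> torsion G n. ((case a' of (x, y) \<Rightarrow> x \<otimes> y) [^] (v * int n),
      (case a' of (x, y) \<Rightarrow> x \<otimes> y) [^] (u * int m)) = a'"
    using torsion_mult_split by auto
  show "(\<lambda>x. (x [^] (v * int n), x [^] (u * int m))) ` torsion G (m * n) \<subseteq> torsion G m \<times> torsion G n"
    using torsion_mult_int_pow[of _ m n v] torsion_mult_int_pow[of _ n m u]
    by (auto simp: mult.commute[of n m])
  show "(\<lambda>(x, y). x \<otimes> y) ` (torsion G m \<times> torsion G n) \<subseteq> torsion G (m * n)"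
  proof clarify
    fix x y assume x: "x \<in> torsion G m" and y: "y \<in> torsion G n"
    then have xy: "x \<in> carrier G" "y \<in> carrier G" "x [^] m = \<one>" "y [^] n = \<one>"
      by (simp_all add: torsion_def)
    have "(x \<otimes> y) [^] (m * n) = (x [^] m) [^] n \<otimes> (y [^] n) [^] m"
      using pow_mult_distrib[OF coprime_torsion_commute[OF x y] xy(1,2)] xy(1,2)
      by (simp add: nat_pow_pow mult.commute)
    then show "x \<otimes> y \<in> torsion G (m * n)" using xy by (simp add: torsion_def)
  qed
qed

text \<open>Forwards, the components are powers of the same common generator. Backwards, generators
  \<open>c\<close> and \<open>d\<close> for the two parts are both powers of
  \<open>c \<otimes> d\<close>, so \<open>x\<close> and \<open>y\<close> are too.\<close>

lemma gen_cyclic_torsion_split: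
  assumes x: "x \<in> torsion G (m * n)" and y: "y \<in> torsion G (m * n)"
  shows "gen_cyclic G x y \<longleftrightarrow>
    gen_cyclic G (x [^] (v * int n)) (y [^] (v * int n)) \<and>
    gen_cyclic G (x [^] (u * int m)) (y [^] (u * int m))"
proof
  have xy: "x \<in> carrier G" "y \<in> carrier G" using x y by (simp_all add: torsion_def)
  {
    assume "gen_cyclic G x y"
    then obtain c and i j :: int where c: "c \<in> carrier G" "x = c [^] i" "y = c [^] j"
      using gen_cyclicD[OF xy] by blast
    then show "gen_cyclic G (x [^] (v * int n)) (y [^] (v * int n)) \<and>
        gen_cyclic G (x [^] (u * int m)) (y [^] (u * int m))"
      using gen_cyclic_int_pow[OF c(1)] by (simp add: int_pow_pow)
  next
    assume *: "gen_cyclic G (x [^] (v * int n)) (y [^] (v * int n)) \<and>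
        gen_cyclic G (x [^] (u * int m)) (y [^] (u * int m))"
    have split: "w [^] (v * int n) \<in> torsion G m" "w [^] (u * int m) \<in> torsion G n"
      if "w \<in> torsion G (m * n)" for w
      using torsion_mult_int_pow[of w m n v] torsion_mult_int_pow[of w n m u] that
      by (simp_all add: mult.commute[of n m])
    obtain c and i j :: int where c: "c \<in> torsion G m" "x [^] (v * int n) = c [^] i"
      "y [^] (v * int n) = c [^] j"
      using gen_cyclic_torsion_bezout split(1) x y * by blast
    obtain d and k l :: int where d: "d \<in> torsion G n" "x [^] (u * int m) = d [^] k"
      "y [^] (u * int m) = d [^] l"
      using gen_cyclic_torsion_bezout split(2) x y * by blast
    have cdG: "c \<otimes> d \<in> carrier G" using c(1) d(1) by (simp add: torsion_def)
    have pow: "c [^] s \<otimes> d [^] t = (c \<otimes> d) [^] (v * int n * s + u * int m * t)" for s t :: int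
      using torsion_mult_split[OF c(1) d(1)] cdG
      by (simp add: int_pow_mult int_pow_pow[symmetric])
    have "x = (c \<otimes> d) [^] (v * int n * i + u * int m * k)"
      using torsion_split_prod[OF xy(1)] c(2) d(2) pow by simp
    moreover have "y = (c \<otimes> d) [^] (v * int n * j + u * int m * l)"
      using torsion_split_prod[OF xy(2)] c(3) d(3) pow by simp
    ultimately show "gen_cyclic G x y" using gen_cyclic_int_pow[OF cdG] by simp
  }
qed

end

end

lemma cyc_iso_torsion_mult:
  assumes G: "group G" "nilpotent_group G" and H: "group H" "nilpotent_group H"
    and cop: "coprime m n"
    and f: "cyc_iso G (torsion G m) H (torsion H m) f"
    and g: "cyc_iso G (torsion G n) H (torsion H n) g"
  obtains h where "cyc_iso G (torsion G (m * n)) H (torsion H (m * n)) h"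
proof -
  obtain u v where uv: "u * int m + v * int n = 1"
    using cop bezout_int[of "int m" "int n"] by auto
  define sG where "sG x = (x [^]\<^bsub>G\<^esub> (v * int n), x [^]\<^bsub>G\<^esub> (u * int m))" for x
  define sH where "sH x = (x [^]\<^bsub>H\<^esub> (v * int n), x [^]\<^bsub>H\<^esub> (u * int m))" for x
  \<comment> \<open>Split in \<open>G\<close>, apply \<open>f\<close> and \<open>g\<close> to the
    components, and reassemble in \<open>H\<close>.\<close>
  define h where "h = inv_into (torsion H (m * n)) sH \<circ> map_prod f g \<circ> sG"
  have sG: "bij_betw sG (torsion G (m * n)) (torsion G m \<times> torsion G n)"
    using group.bij_betw_torsion_split[OF G uv] by (simp add: sG_def[abs_def])
  have sH: "bij_betw sH (torsion H (m * n)) (torsion H m \<times> torsion H n)"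
    using group.bij_betw_torsion_split[OF H uv] by (simp add: sH_def[abs_def])
  have fg: "bij_betw (map_prod f g) (torsion G m \<times> torsion G n) (torsion H m \<times> torsion H n)"
  proof -
    have "bij_betw f (torsion G m) (torsion H m)" "bij_betw g (torsion G n) (torsion H n)"
      using f g by (simp_all add: cyc_iso_def)
    then show ?thesis by (simp add: bij_betw_def map_prod_inj_on map_prod_surj_on)
  qed
  have bij: "bij_betw h (torsion G (m * n)) (torsion H (m * n))"
    using bij_betw_trans[OF bij_betw_trans[OF sG fg] bij_betw_inv_into[OF sH]]
    by (simp add: h_def comp_assoc)
  have sh: "sH (h x) = map_prod f g (sG x)" if x: "x \<in> torsion G (m * n)" for x
    using bij_betwE[OF bij_betw_trans[OF sG fg]] x sH
    unfolding h_def by (simp add: bij_betw_inv_into_right)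
  have "gen_cyclic G x y \<longleftrightarrow> gen_cyclic H (h x) (h y)"
    if x: "x \<in> torsion G (m * n)" and y: "y \<in> torsion G (m * n)" for x y
  proof -
    have hxy: "h x \<in> torsion H (m * n)" "h y \<in> torsion H (m * n)"
      using bij x y by (auto dest: bij_betwE)
    have s: "fst (sG x) \<in> torsion G m" "snd (sG x) \<in> torsion G n"
      "fst (sG y) \<in> torsion G m" "snd (sG y) \<in> torsion G n"
      using bij_betwE[OF sG] x y by (metis mem_Times_iff)+
    have "gen_cyclic G x y \<longleftrightarrow>
        gen_cyclic G (fst (sG x)) (fst (sG y)) \<and> gen_cyclic G (snd (sG x)) (snd (sG y))"
      using group.gen_cyclic_torsion_split[OF G uv x y] by (simp add: sG_def)
    also have "\<dots> \<longleftrightarrow>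
        gen_cyclic H (f (fst (sG x))) (f (fst (sG y))) \<and> gen_cyclic H (g (snd (sG x))) (g (snd (sG y)))"
      using f g s by (simp add: cyc_iso_def)
    also have "\<dots> \<longleftrightarrow>
        gen_cyclic H (fst (sH (h x))) (fst (sH (h y))) \<and> gen_cyclic H (snd (sH (h x))) (snd (sH (h y)))"
      using sh x y by simp
    also have "\<dots> \<longleftrightarrow> gen_cyclic H (h x) (h y)"
      using group.gen_cyclic_torsion_split[OF H uv hxy] by (simp add: sH_def)
    finally show ?thesis .
  qed
  then show ?thesis using that bij by (auto simp: cyc_iso_def)
qed

lemma cyc_iso_torsion_prod_primes:
  assumes G: "group G" "nilpotent_group G" and H: "group H" "nilpotent_group H"
    and S: "finite S" "\<And>p. p \<in> S \<Longrightarrow> Factorial_Ring.prime (p::nat)"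
    and iso: "\<And>p. p \<in> S \<Longrightarrow> \<exists>f. cyc_iso G (torsion G (p ^ e p)) H (torsion H (p ^ e p)) f"
  shows "\<exists>f. cyc_iso G (torsion G (\<Prod>p\<in>S. p ^ e p)) H (torsion H (\<Prod>p\<in>S. p ^ e p)) f"
  using S iso
proof (induction S rule: finite_induct)
  case empty
  interpret G: group G by fact
  interpret H: group H by fact
  have "torsion G 1 = {\<one>\<^bsub>G\<^esub>}" "torsion H 1 = {\<one>\<^bsub>H\<^esub>}" by (auto simp: torsion_def)
  then have "cyc_iso G (torsion G 1) H (torsion H 1) (\<lambda>_. \<one>\<^bsub>H\<^esub>)"
    using G.gen_cyclic_refl H.gen_cyclic_refl by (simp add: cyc_iso_def bij_betw_def)
  then show ?case by auto
next
  case (insert q S)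
  have "coprime (q ^ e q) (\<Prod>p\<in>S. p ^ e p)"
  proof (rule prod_coprime_right)
    fix p assume "p \<in> S"
    then have "p \<noteq> q" "Factorial_Ring.prime p" "Factorial_Ring.prime q" using insert by auto
    then show "coprime (q ^ e q) (p ^ e p)" by (simp add: primes_coprime)
  qed
  moreover obtain f where "cyc_iso G (torsion G (q ^ e q)) H (torsion H (q ^ e q)) f"
    using insert.prems by blast
  moreover obtain g where
    "cyc_iso G (torsion G (\<Prod>p\<in>S. p ^ e p)) H (torsion H (\<Prod>p\<in>S. p ^ e p)) g"
    using insert by blast
  ultimately show ?case
    unfolding prod.insert[OF insert.hyps] using cyc_iso_torsion_mult[OF G H] by blast
qed

lemma (in group) torsion_order: "finite (carrier G) \<Longrightarrow> torsion G (order G) = carrier G"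
  using pow_order_eq_1 by (auto simp: torsion_def)

theorem theorem4:
  fixes G :: "('a, 'b) monoid_scheme" and H :: "('c, 'd) monoid_scheme"
  assumes "nilpotent_group G" and "group H"
    and "finite (carrier G)" and "finite (carrier H)"
    and "order G = order H"
  shows "cyclic_graph_iso G H \<longleftrightarrow>
           (nilpotent_group H \<and>
            (\<forall>p P Q. Factorial_Ring.prime (p::nat) \<longrightarrow> sylow_subgroup G p P \<longrightarrow> sylow_subgroup H p Q \<longrightarrow>
                cyclic_graph_iso (G\<lparr>carrier := P\<rparr>) (H\<lparr>carrier := Q\<rparr>)))"
proof -
  have G: "group G" using assms(1) by (simp add: nilpotent_group_def)
  note H = \<open>group H\<close> and finG = \<open>finite (carrier G)\<close> and finH = \<open>finite (carrier H)\<close>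
  let ?n = "\<lambda>p. p ^ multiplicity p (order G)"
  have sylG: "P = torsion G (?n p)" if "Factorial_Ring.prime p" "sylow_subgroup G p P" for p P
    using group.nilpotent_sylow_eq_torsion[OF G assms(1) finG] that by blast
  have sylH: "Q = torsion H (?n p)"
    if "nilpotent_group H" "Factorial_Ring.prime p" "sylow_subgroup H p Q" for p Q
    using group.nilpotent_sylow_eq_torsion[OF H that(1) finH that(2,3)] assms(5) by simp
  have sylow_iso: "cyclic_graph_iso (G\<lparr>carrier := P\<rparr>) (H\<lparr>carrier := Q\<rparr>) \<longleftrightarrow>
      (\<exists>f. cyc_iso G (torsion G (?n p)) H (torsion H (?n p)) f)"
    if p: "nilpotent_group H" "Factorial_Ring.prime p" "sylow_subgroup G p P" "sylow_subgroup H p Q"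
    for p P Q
  proof -
    have "subgroup P G" "subgroup Q H" "card P = card Q"
      using p assms(5) by (simp_all add: sylow_subgroup_def)
    moreover have "finite P" "finite Q"
      using calculation finG finH by (meson finite_subset subgroup.subset)+
    ultimately show ?thesis
      using cyclic_graph_iso_subgroup_iff[OF G H] sylG[OF p(2,3)] sylH[OF p(1,2,4)] by simp
  qed
  show ?thesis
  proof
    assume "cyclic_graph_iso G H"
    then obtain f where f: "cyc_iso G (carrier G) H (carrier H) f"
      using cyclic_graph_iso_iff_cyc_iso[OF G H finG finH assms(5)] by blast
    have iso: "\<exists>g. cyc_iso G (torsion G n) H (torsion H n) g" for n
      using cyc_iso_torsion[OF G H finG f] by metis
    have "nilpotent_group H"
    proof (rule group.torsion_sylow_imp_nilpotent[OF H finH])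
      fix p :: nat assume p: "Factorial_Ring.prime p"
      obtain P where P: "sylow_subgroup G p P" using group.sylow_subgroup_exists[OF G finG p] .
      obtain Q where Q: "sylow_subgroup H p Q" using group.sylow_subgroup_exists[OF H finH p] .
      \<comment> \<open>In \<open>G\<close> this torsion set is a Sylow subgroup, so the transported
        count leaves no room in \<open>H\<close> for elements outside \<open>Q\<close>.\<close>
      have "card (torsion G (?n p)) = card (torsion H (?n p))"
        using iso bij_betw_same_card unfolding cyc_iso_def by blast
      then have "card (torsion H (?n p)) = card Q"
        using sylG[OF p P] P Q assms(5) by (simp add: sylow_subgroup_def)
      moreover have "Q \<subseteq> torsion H (?n p)"
        using group.subgroup_subset_torsion[OF H finH, of Q] Q assms(5) by (simp add: sylow_subgroup_def)
      moreover have "finite (torsion H (?n p))" using finH by (simp add: torsion_def)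
      ultimately have "Q = torsion H (?n p)" by (simp add: card_subset_eq)
      then show "sylow_subgroup H p (torsion H (p ^ multiplicity p (order H)))"
        using Q assms(5) by simp
    qed
    then show "nilpotent_group H \<and>
        (\<forall>p P Q. Factorial_Ring.prime (p::nat) \<longrightarrow> sylow_subgroup G p P \<longrightarrow> sylow_subgroup H p Q \<longrightarrow>
          cyclic_graph_iso (G\<lparr>carrier := P\<rparr>) (H\<lparr>carrier := Q\<rparr>))"
      using sylow_iso iso by blast
  next
    assume *: "nilpotent_group H \<and>
        (\<forall>p P Q. Factorial_Ring.prime (p::nat) \<longrightarrow> sylow_subgroup G p P \<longrightarrow> sylow_subgroup H p Q \<longrightarrow>
          cyclic_graph_iso (G\<lparr>carrier := P\<rparr>) (H\<lparr>carrier := Q\<rparr>))"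
    have iso: "\<exists>f. cyc_iso G (torsion G (?n p)) H (torsion H (?n p)) f"
      if p: "Factorial_Ring.prime p" for p
    proof -
      obtain P where P: "sylow_subgroup G p P" using group.sylow_subgroup_exists[OF G finG p] .
      obtain Q where Q: "sylow_subgroup H p Q" using group.sylow_subgroup_exists[OF H finH p] .
      show ?thesis using sylow_iso[OF _ p P Q] * p P Q by blast
    qed
    have "order G \<noteq> 0" 
      using finG monoid.order_gt_0_iff_finite[OF group.is_monoid[OF G]] by simp
    \<comment> \<open>The exponent \<open>order G\<close> has the whole group as its torsion in both
      \<open>G\<close> and \<open>H\<close>, so gluing over all prime factors yields a bijection of
      the carriers.\<close>
    then have "(\<Prod>p\<in>prime_factors (order G). ?n p) = order G"
      by (simp add: prod_prime_factors)
    moreover have "\<exists>f. cyc_iso G (torsion G (\<Prod>p\<in>prime_factors (order G). ?n p))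
        H (torsion H (\<Prod>p\<in>prime_factors (order G). ?n p)) f"
      using * iso by (intro cyc_iso_torsion_prod_primes[OF G assms(1) H]) auto
    ultimately have "\<exists>f. cyc_iso G (carrier G) H (carrier H) f"
      using group.torsion_order[OF G finG] group.torsion_order[OF H finH] assms(5) by simp
    then show "cyclic_graph_iso G H"
      using cyclic_graph_iso_iff_cyc_iso[OF G H finG finH assms(5)] by blast
  qed
qed

end
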